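(* Let $\ell,m\ge3$ with $(\ell-2)(m-2)\ge4$ and let $G_{\ell,m}(X)=\sum_{\gamma}X^{|\gamma|}$, the sum ranging over all geodesic paths $\gamma$ in $X_{\ell,m}$ starting at $*$ (including the trivial path of length $0$); equivalently $G_{\ell,m}(X)=\sum_{s\in V(X_{\ell,m})}\lambda(s)X^{|s|}$ where $\lambda(s)$ is the number of geodesics from $*$ to $s$. If $m=2w$ is even, then $$G_{\ell,m}(X)=\frac{1+2X+\dots+2X^{w-1}+X^w+(X^w-X^{w-1})}{1-(\ell-2)X-\dots-(\ell-2)X^{w-1}+X^w+(X^w-X^{w-1})}.$$ If $m=2w+1$ is odd, then $$G_{\ell,m}(X)=\frac{1+2X+\dots+2X^{w-1}+4X^w+2X^{w+1}+\dots+2X^{m-2}+X^{m-1}+(X^{m-1}-X^{m-2})}{1-(\ell-2)X-\dots-(\ell-2)X^{w-1}-(\ell-4)X^w-(\ell-2)X^{w+1}-\dots-(\ell-2)X^{m-2}+X^{m-1}+(X^{m-1}-X^{m-2})},$$ where in the numerator the coefficient of $X^k$ before the correction term is $1$ for $k=0,m-1$, $4$ for $k=w$ and $2$ for the other $1\le k\le m-2$, and in the denominator it is $1$ for $k=0,m-1$, $-(\ell-4)$ for $k=w$ and $-(\ell-2)$ for the other $1\le k\le m-2$.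
   Context: For integers $\ell,m\ge3$ with $(\ell-2)(m-2)\ge4$, $X_{\ell,m}$ denotes the graph which is the $1$-skeleton of the regular tessellation of the Euclidean or hyperbolic plane by regular $m$-gons with $\ell$ of them meeting at each vertex (unique up to isometry). A base vertex $*$ is fixed and $|x|=d( *,x)$ is graph distance. A path $\gamma=(\gamma_0,\dots,\gamma_n)$ has length $|\gamma|=n$ and is geodesic if $d(\gamma_0,\gamma_n)=n$. The identity is one of formal power series. *)

theory Defs
  imports "HOL-Computational_Algebra.Formal_Power_Series"
begin

text \<open>The graph X_{l,m} is realised combinatorially as the coset graph of the
Coxeter group [m,l] = <r0,r1,r2 | ri^2, (r0 r1)^m, (r1 r2)^l, (r0 r2)^2>
with respect to the vertex stabiliser <r1,r2>: vertices are the cosets g<r1,r2>,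
and g<r1,r2> is adjacent to g r0 <r1,r2>.  This is the 1-skeleton of the regular
tessellation {m,l} (m-gons, l at each vertex).\<close>

datatype gen = R0 | R1 | R2

definition coxrel :: "nat \<Rightarrow> nat \<Rightarrow> gen list \<Rightarrow> bool" where
  "coxrel l m x \<longleftrightarrow>
     (\<exists>a. x = [a, a]) \<or> x = concat (replicate m [R0, R1]) \<or>
     x = concat (replicate l [R1, R2]) \<or> x = [R0, R2, R0, R2]"

inductive geq :: "nat \<Rightarrow> nat \<Rightarrow> gen list \<Rightarrow> gen list \<Rightarrow> bool" for l m where
  geq_refl: "geq l m w w"
| geq_sym: "geq l m u v \<Longrightarrow> geq l m v u"
| geq_trans: "geq l m u v \<Longrightarrow> geq l m v w \<Longrightarrow> geq l m u w"
| geq_rel: "coxrel l m x \<Longrightarrow> geq l m (u @ x @ v) (u @ v)"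

definition coset_eq :: "nat \<Rightarrow> nat \<Rightarrow> gen list \<Rightarrow> gen list \<Rightarrow> bool" where
  "coset_eq l m u v \<longleftrightarrow> (\<exists>h. set h \<subseteq> {R1, R2} \<and> geq l m u (v @ h))"

definition vclass :: "nat \<Rightarrow> nat \<Rightarrow> gen list \<Rightarrow> gen list set" where
  "vclass l m w = {u. coset_eq l m u w}"

definition verts :: "nat \<Rightarrow> nat \<Rightarrow> gen list set set" where
  "verts l m = range (vclass l m)"

definition base :: "nat \<Rightarrow> nat \<Rightarrow> gen list set" where
  "base l m = vclass l m []"

definition adj :: "nat \<Rightarrow> nat \<Rightarrow> gen list set \<Rightarrow> gen list set \<Rightarrow> bool" where
  "adj l m A B \<longleftrightarrow> (\<exists>w. A = vclass l m w \<and> B = vclass l m (w @ [R0]))"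

definition is_path :: "nat \<Rightarrow> nat \<Rightarrow> gen list set list \<Rightarrow> bool" where
  "is_path l m p \<longleftrightarrow> p \<noteq> [] \<and> set p \<subseteq> verts l m \<and>
     (\<forall>i. Suc i < length p \<longrightarrow> adj l m (p ! i) (p ! Suc i))"

definition gdist :: "nat \<Rightarrow> nat \<Rightarrow> gen list set \<Rightarrow> gen list set \<Rightarrow> nat" where
  "gdist l m x y = (LEAST n. \<exists>p. is_path l m p \<and> hd p = x \<and> last p = y \<and> length p = Suc n)"

definition geodesic_from_base :: "nat \<Rightarrow> nat \<Rightarrow> gen list set list \<Rightarrow> bool" where
  "geodesic_from_base l m p \<longleftrightarrow> is_path l m p \<and> hd p = base l m \<and>
     gdist l m (hd p) (last p) = length p - 1"

definition Gser :: "nat \<Rightarrow> nat \<Rightarrow> real fps" where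
  "Gser l m = Abs_fps (\<lambda>n. real (card {p. geodesic_from_base l m p \<and> length p = Suc n}))"

end

(* Label every vertex of the tessellation by its distance to the base vertex.  Read from left to
   right, two consecutive vertices of a sphere bound a gap, the part of the sphere inside a single
   m-gon; its height grows by one per level.  A gap that is too high closes: for even m, at height
   w = m/2 its two sides meet in a vertex with two parents; for odd m its two sides are joined by a
   horizontal edge at height w, and they meet at height m - 1.  New gaps start at height 1 between
   two consecutive ascending edges of a vertex.  This describes a planar map by darts with a
   rotation and a flip, satisfying the relations of the triangle group, so words in the Coxeter
   generators act on its flags.  Conversely a dart determines a word class, built along its
   descending path, and this assignment is equivariant because each gap closes up along an m-gon;
   hence the action is simply transitive and the coset graph is the graph of the map.  Geodesics
   are the ascending paths.  Let P count them by length, let A(h) count their endpoints, each with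
   multiplicity the number of adjacent gaps of height h, and let K be the largest gap height.  Then
   A(h+1) = X A(h), the ascending paths ending in a vertex with two parents are counted by X A(K),
   and the sum of all A(h) is 2(P - 1), which together with the degree count determines P. *)
theory Submission
  imports Defs
begin

section \<open>Gaps, neighbours and rotation\<close>

text \<open>A vertex is the list of child indices along a descending path to the base vertex \<open>[]\<close>, the
last step first.  A dart \<open>Up v i\<close> leaves \<open>v\<close> along its ascending edge number \<open>i\<close>, counted from left to
right, and \<open>Dn v i\<close> is the same edge seen from its upper end; \<open>Hr v\<close> and \<open>Hl v\<close> leave \<open>v\<close> along the
horizontal edges to its right and left.\<close>

datatype dart = Up "nat list" nat | Dn "nat list" nat | Hr "nat list" | Hl "nat list"

section \<open>Parameters, gap heights and vertex types\<close>

locale layers =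
  fixes l m :: nat
  assumes l3: "l \<ge> 3" and m3: "m \<ge> 3"
    and curvature: "l \<ge> 6 \<or> (l \<ge> 4 \<and> m \<ge> 4) \<or> m \<ge> 6"
begin

definition odd_face :: bool where "odd_face \<longleftrightarrow> odd m"

definition w :: nat where "w = m div 2"

definition K :: nat where "K = (if odd m then m - 2 else m div 2 - 1)"

lemma w1: "w \<ge> 1" and K1: "K \<ge> 1"
  using m3 by (auto simp: w_def K_def)

lemma m_eq: "m = (if odd_face then 2 * w + 1 else 2 * w)"
  by (simp add: odd_face_def w_def)

lemma w_ge: "k * 2 \<le> m \<Longrightarrow> k \<le> w"
  by (simp add: w_def)

lemma K_eq: "K = (if odd_face then 2 * w - 1 else w - 1)"
  by (auto simp: odd_face_def w_def K_def elim!: oddE)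

definition hz :: "nat \<Rightarrow> nat" where
  "hz h = (if odd_face \<and> h = w then 1 else 0)"

text \<open>A vertex type consists of the number of parents and the heights of the gaps to the left and
to the right; the gap heights 0 of the base vertex are a convention, which makes its children come
out right.\<close>

fun vtyp_deg :: "nat \<times> nat \<times> nat \<Rightarrow> nat" where
  "vtyp_deg (k, a, b) = l - k - hz a - hz b"

fun vtyp :: "nat list \<Rightarrow> nat \<times> nat \<times> nat" where
  "vtyp [] = (0, 0, 0)"
| "vtyp (i # v) =
    (case vtyp v of (k, a, b) \<Rightarrow>
       if Suc i = vtyp_deg (k, a, b) \<and> b = K then (2, 1, 1)
       else (1, if i > 0 then 1 else Suc a, if Suc i < vtyp_deg (k, a, b) then 1 else Suc b))"

definition np :: "nat list \<Rightarrow> nat" where "np v = fst (vtyp v)"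
definition lg :: "nat list \<Rightarrow> nat" where "lg v = fst (snd (vtyp v))"
definition rg :: "nat list \<Rightarrow> nat" where "rg v = snd (snd (vtyp v))"
definition deg :: "nat list \<Rightarrow> nat" where "deg v = l - np v - hz (lg v) - hz (rg v)"

lemma hz0 [simp]: "hz 0 = 0"
  using w1 by (simp add: hz_def)

lemma typ_Nil [simp]: "np [] = 0" "lg [] = 0" "rg [] = 0" "deg [] = l"
  by (simp_all add: np_def lg_def rg_def deg_def)

lemma typ_Cons:
  "np (i # v) = (if Suc i = deg v \<and> rg v = K then 2 else 1)"
  "lg (i # v) = (if Suc i = deg v \<and> rg v = K then 1 else if i > 0 then 1 else Suc (lg v))"
  "rg (i # v) = (if Suc i = deg v \<and> rg v = K then 1 else if Suc i < deg v then 1 else Suc (rg v))"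
  by (auto simp: np_def lg_def rg_def deg_def split: prod.splits)

text \<open>A vertex with two parents is encoded as the last child of its left parent, so child 0 of its
right parent is not a valid code.\<close>

fun valid :: "nat list \<Rightarrow> bool" where
  "valid [] = True"
| "valid (i # v) = (valid v \<and> i < deg v \<and> \<not> (i = 0 \<and> lg v = K))"

text \<open>Both gaps are higher than 1 only just above a vertex with a single ascending edge.  For \<open>l < 6\<close>
this restricts the types enough to guarantee an ascending edge, and two of them below a closing
gap.\<close>

lemma typ_invariant:
  assumes "valid v" "v \<noteq> []"
  shows "1 \<le> lg v \<and> lg v \<le> K \<and> 1 \<le> rg v \<and> rg v \<le> K \<and> (np v = 1 \<or> np v = 2 \<and> lg v = 1 \<and> rg v = 1)
    \<and> (l < 6 \<longrightarrow> lg v = 1 \<or> rg v = 1 \<or>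
        l = 3 \<and> (lg v = 2 \<and> rg v = 2 \<or> odd_face \<and> (lg v = w + 1 \<and> rg v = 2 \<or> lg v = 2 \<and> rg v = w + 1)))"
  using assms
proof (induction v)
  case (Cons i v)
  show ?case
  proof (cases "v = []")
    case True
    then show ?thesis using Cons.prems K1 l3 by (auto simp: typ_Cons)
  next
    case False
    have IH: "1 \<le> lg v" "lg v \<le> K" "1 \<le> rg v" "rg v \<le> K" "np v = 1 \<or> np v = 2 \<and> lg v = 1 \<and> rg v = 1"
       "l < 6 \<longrightarrow> lg v = 1 \<or> rg v = 1 \<or>
        l = 3 \<and> (lg v = 2 \<and> rg v = 2 \<or> odd_face \<and> (lg v = w + 1 \<and> rg v = 2 \<or> lg v = 2 \<and> rg v = w + 1))"
      using Cons False by auto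
    have v: "i < deg v" "\<not> (i = 0 \<and> lg v = K)" using Cons.prems by auto
    show ?thesis
    proof (cases "Suc i = deg v \<and> rg v = K")
      case True
      then show ?thesis using K1 by (auto simp: typ_Cons)
    next
      case nm: False
      have 1: "1 \<le> lg (i # v) \<and> lg (i # v) \<le> K \<and> 1 \<le> rg (i # v) \<and> rg (i # v) \<le> K \<and> np (i # v) = 1"
        using nm IH(1-4) v K1 by (auto simp: typ_Cons)
      have 2: "lg (i # v) = 1 \<or> rg (i # v) = 1 \<or>
         (deg v = 1 \<and> lg (i # v) = Suc (lg v) \<and> rg (i # v) = Suc (rg v))"
        using nm v by (auto simp: typ_Cons)
      \<comment> \<open>By fact \<open>2\<close> both gaps exceed 1 only above a single ascending
        edge. For \<open>l < 6\<close> this leaves \<open>l = 3\<close> with either two parents, or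
        one parent and one horizontal edge opposite a gap of height 1.\<close>
      have 3: "l = 3 \<and> (lg v = 1 \<and> rg v = 1 \<or> odd_face \<and> (lg v = w \<and> rg v = 1 \<or> lg v = 1 \<and> rg v = w))"
        if "l < 6" "deg v = 1"
      proof -
        have w: "w \<ge> 2" "l = 3 \<Longrightarrow> w \<ge> 3"
          using that(1) curvature w_ge[of 2] w_ge[of 3] by linarith+
        have "l - np v - hz (lg v) - hz (rg v) = 1" using that(2) by (simp add: deg_def)
        then show ?thesis using that(1) IH(5,6) w l3 unfolding hz_def
          by (auto split: if_splits)
      qed
      show ?thesis using 1 2 3 by auto
    qed
  qed
qed simp

text \<open>The second ascending edge below a closing gap gives a vertex with two parents a gap of
  height 1 on either side, as \<open>vtyp\<close> assumes. For \<open>l \<ge> 6\<close> it suffices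
  that at most four edges do not ascend; for smaller \<open>l\<close> the invariant bounds their
  number.\<close>

lemma deg_bounds:
  assumes "valid v"
  shows "deg v > 0 \<and> (lg v = K \<or> rg v = K \<longrightarrow> deg v \<ge> 2)"
proof (cases "v = []")
  case True
  then show ?thesis using l3 K1 by simp
next
  case False
  note inv = typ_invariant[OF assms False]
  have hz: "hz h \<le> 1" for h by (simp add: hz_def)
  consider "l \<ge> 6" | "l < 6" "l \<ge> 4" "w \<ge> 2" | "l = 3" "w \<ge> 3"
    using curvature l3 w_ge[of 2] w_ge[of 3] by linarith
  then show ?thesis
  proof cases
    case 1
    then show ?thesis using inv hz[of "lg v"] hz[of "rg v"] unfolding deg_def by linarith
  next
    case 2
    have "hz 1 = 0" using 2 by (simp add: hz_def)
    moreover have "lg v = 1 \<or> rg v = 1" using 2 inv by auto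
    ultimately have "np v + hz (lg v) + hz (rg v) \<le> 2"
      using inv hz[of "lg v"] hz[of "rg v"] by auto
    then show ?thesis using 2 unfolding deg_def by linarith
  next
    case 3
    then show ?thesis using inv K_eq unfolding deg_def hz_def by (auto split: if_splits)
  qed
qed

lemma deg_pos: "valid v \<Longrightarrow> deg v > 0"
  and deg_ge2: "valid v \<Longrightarrow> lg v = K \<or> rg v = K \<Longrightarrow> deg v \<ge> 2"
  using deg_bounds by auto

text \<open>Positivity of \<open>deg\<close> shows that the truncated subtraction in its definition
  loses nothing: every vertex has valency \<open>l\<close>.\<close>

lemma np_sum: "valid v \<Longrightarrow> np v + hz (lg v) + hz (rg v) + deg v = l"
  using deg_pos[of v] unfolding deg_def by linarith

section \<open>Left and right neighbours on a sphere\<close>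

fun nxt :: "nat list \<Rightarrow> nat list" where
  "nxt [] = []"
| "nxt (i # v) =
    (if Suc i < deg v then Suc i # v else (if rg v = K then 1 else 0) # nxt v)"

fun prv :: "nat list \<Rightarrow> nat list" where
  "prv [] = []"
| "prv (i # v) =
    (if i = (if lg v = K then 1 else 0) then (deg (prv v) - 1) # prv v else (i - 1) # v)"

lemma length_nxt [simp]: "length (nxt v) = length v"
  by (induction v) auto

lemma length_prv [simp]: "length (prv v) = length v"
  by (induction v) auto

text \<open>After the last child of a vertex come the children of the next vertex. At a closing gap
  these start with index 1, since index 0 is the shared vertex already listed with its left parent.
  The base is its own neighbour, which makes every sphere cyclic.\<close>

lemma nxt_props: "valid v \<Longrightarrow> valid (nxt v) \<and> lg (nxt v) = rg v \<and> prv (nxt v) = v"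
proof (induction v)
  case (Cons i v)
  then have v: "valid v" "i < deg v" "\<not> (i = 0 \<and> lg v = K)"
    and IH: "valid (nxt v)" "lg (nxt v) = rg v" "prv (nxt v) = v" by auto
  show ?case
  proof (cases "Suc i < deg v")
    case True
    then show ?thesis using v by (auto simp: typ_Cons)
  next
    case False
    then have i: "Suc i = deg v" using v by simp
    show ?thesis
      using i v IH deg_pos[OF IH(1)] deg_ge2[OF IH(1)] by (auto simp: typ_Cons)
  qed
qed simp

lemma prv_props: "valid v \<Longrightarrow> valid (prv v) \<and> rg (prv v) = lg v \<and> nxt (prv v) = v"
proof (induction v)
  case (Cons i v)
  then have v: "valid v" "i < deg v" "\<not> (i = 0 \<and> lg v = K)"
    and IH: "valid (prv v)" "rg (prv v) = lg v" "nxt (prv v) = v" by auto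
  show ?case
    using v IH deg_pos[OF IH(1)] deg_ge2[OF IH(1)] deg_ge2[OF v(1)] K1 by (auto simp: typ_Cons)
qed simp

lemma nxt_neq: "valid v \<Longrightarrow> v \<noteq> [] \<Longrightarrow> nxt v \<noteq> v"
proof (induction v)
  case (Cons i v)
  show ?case
  proof (cases "v = []")
    case True
    then show ?thesis using Cons.prems l3 K1 by auto
  next
    case False
    then show ?thesis using Cons by auto
  qed
qed simp

lemma prv_neq: "valid v \<Longrightarrow> v \<noteq> [] \<Longrightarrow> prv v \<noteq> v"
  using nxt_neq prv_props by metis

definition child :: "nat list \<Rightarrow> nat \<Rightarrow> nat list" where
  "child v i = (if i = 0 \<and> lg v = K then (deg (prv v) - 1) # prv v else i # v)"

lemma lg_root_neq: "lg v = K \<Longrightarrow> v \<noteq> []"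
  using K1 by auto

lemma valid_child: "valid v \<Longrightarrow> i < deg v \<Longrightarrow> valid (child v i)"
  unfolding child_def using prv_props[of v] deg_pos[of "prv v"] deg_ge2[of "prv v"] by auto

lemma length_child [simp]: "length (child v i) = Suc (length v)"
  by (simp add: child_def)

lemma inj_child: "valid v \<Longrightarrow> inj_on (child v) {..<deg v}"
  unfolding inj_on_def child_def using prv_neq[OF _ lg_root_neq, of v] by auto

section \<open>Darts, flip and rotation\<close>

fun dvalid :: "dart \<Rightarrow> bool" where
  "dvalid (Up v i) = (valid v \<and> i < deg v)"
| "dvalid (Dn v i) = (valid v \<and> i < deg v)"
| "dvalid (Hr v) = (valid v \<and> odd_face \<and> rg v = w)"
| "dvalid (Hl v) = (valid v \<and> odd_face \<and> lg v = w)"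

fun vt :: "dart \<Rightarrow> nat list" where
  "vt (Up v i) = v"
| "vt (Dn v i) = child v i"
| "vt (Hr v) = v"
| "vt (Hl v) = v"

fun flip :: "dart \<Rightarrow> dart" where
  "flip (Up v i) = Dn v i"
| "flip (Dn v i) = Up v i"
| "flip (Hr v) = Hl (nxt v)"
| "flip (Hl v) = Hr (prv v)"

text \<open>The rightmost descending dart. The base has no parent; there the value
  \<open>Up [] 0\<close> lets the rotation wrap around after the last ascending edge.\<close>

fun rdown :: "nat list \<Rightarrow> dart" where
  "rdown [] = Up [] 0"
| "rdown (i # v) = (if np (i # v) = 2 then Dn (nxt v) 0 else Dn v i)"

text \<open>The cyclic order at a vertex is: ascending edges, right horizontal edge, right parent, left
parent, left horizontal edge.\<close>

definition rlast :: "nat list \<Rightarrow> dart" where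
  "rlast v = (if odd_face \<and> rg v = w then Hr v else rdown v)"

definition lfirst :: "nat list \<Rightarrow> dart" where
  "lfirst v = (if odd_face \<and> lg v = w then Hl v else Up v 0)"

fun rot :: "dart \<Rightarrow> dart" where
  "rot (Up v i) = (if Suc i < deg v then Up v (Suc i) else rlast v)"
| "rot (Hr v) = rdown v"
| "rot (Dn v i) = (if i = 0 \<and> lg v = K then Dn (prv v) (deg (prv v) - 1) else lfirst (i # v))"
| "rot (Hl v) = Up v 0"

lemma flip_valid: "dvalid d \<Longrightarrow> dvalid (flip d)"
  using nxt_props prv_props by (cases d) auto

lemma flip_flip: "dvalid d \<Longrightarrow> flip (flip d) = d"
  using nxt_props prv_props by (cases d) auto

lemma valid_lfirst: "valid v \<Longrightarrow> dvalid (lfirst v) \<and> vt (lfirst v) = v"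
  using deg_pos by (auto simp: lfirst_def)

lemma valid_rdown: "valid v \<Longrightarrow> dvalid (rdown v) \<and> vt (rdown v) = v"
proof (cases v)
  case Nil
  then show ?thesis using l3 by simp
next
  case (Cons i u)
  assume "valid v"
  then show ?thesis using Cons nxt_props[of u] deg_ge2[of "nxt u"]
    by (auto simp: typ_Cons child_def split: if_splits)
qed

lemma valid_rlast: "valid v \<Longrightarrow> dvalid (rlast v) \<and> vt (rlast v) = v"
  using valid_rdown by (auto simp: rlast_def)

lemma rot_valid: "dvalid d \<Longrightarrow> dvalid (rot d) \<and> vt (rot d) = vt d"
proof (cases d)
  case (Dn v i)
  assume "dvalid d"
  then have v: "valid v" "i < deg v" using Dn by auto
  show ?thesis
  proof (cases "i = 0 \<and> lg v = K")
    case True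
    then show ?thesis using Dn v prv_props[OF v(1)] deg_ge2[of "prv v"]
      by (auto simp: child_def)
  next
    case False
    then show ?thesis using Dn v valid_lfirst[of "i # v"] by (auto simp: child_def)
  qed
qed (use valid_rlast valid_rdown deg_pos in auto)

lemma rot_Up_pow: "k + i < deg v \<Longrightarrow> (rot ^^ k) (Up v i) = Up v (k + i)"
  by (induction k) auto

lemma rot_Up_deg: "valid v \<Longrightarrow> (rot ^^ deg v) (Up v 0) = rlast v"
  using rot_Up_pow[of "deg v - 1" 0 v] deg_pos[of v] by (cases "deg v") auto

lemma rot_rlast: "(rot ^^ hz (rg v)) (rlast v) = rdown v"
  by (simp add: hz_def rlast_def)

lemma rot_lfirst: "(rot ^^ hz (lg v)) (lfirst v) = Up v 0"
  by (simp add: hz_def lfirst_def)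

lemma rot_rdown: "valid v \<Longrightarrow> (rot ^^ np v) (rdown v) = lfirst v"
proof (cases v)
  case Nil
  then show ?thesis using w1 by (simp add: lfirst_def)
next
  case (Cons i u)
  assume "valid v"
  then have u: "valid u" "i < deg u" "\<not> (i = 0 \<and> lg u = K)" using Cons by auto
  show ?thesis
  proof (cases "np v = 2")
    case True
    then have i: "i = deg u - 1" and "rg u = K" using Cons by (auto simp: typ_Cons split: if_splits)
    then show ?thesis using True Cons u nxt_props[OF u(1)] deg_ge2[OF u(1)]
      by (auto simp: numeral_2_eq_2)
  next
    case False
    then have "np v = 1" using Cons by (auto simp: typ_Cons split: if_splits)
    then show ?thesis using False Cons u by auto
  qed
qed

text \<open>One rotation passes the ascending edges, the right horizontal edge, the parents and the
  left horizontal edge; by \<open>np_sum\<close> these add up to \<open>l\<close>.\<close>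

lemma rot_orbit_parts:
  assumes "valid v"
  shows "(rot ^^ (hz (rg v) + deg v)) (Up v 0) = rdown v"
    and "(rot ^^ (np v + (hz (rg v) + deg v))) (Up v 0) = lfirst v"
    and "(rot ^^ l) (Up v 0) = Up v 0"
proof -
  show 1: "(rot ^^ (hz (rg v) + deg v)) (Up v 0) = rdown v"
    by (simp add: funpow_add rot_Up_deg[OF assms] rot_rlast)
  show 2: "(rot ^^ (np v + (hz (rg v) + deg v))) (Up v 0) = lfirst v"
    using 1 by (simp add: funpow_add rot_rdown[OF assms])
  have "l = hz (lg v) + (np v + (hz (rg v) + deg v))" using np_sum[OF assms] by simp
  then show "(rot ^^ l) (Up v 0) = Up v 0"
    using 2 rot_lfirst[of v] by (metis funpow_add comp_apply)
qed

text \<open>This reduces the vertex relation to the dart \<open>Up v 0\<close>, and later makes the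
  vertex stabiliser transitive on the flags at a vertex.\<close>

lemma rot_transitive: "dvalid d \<Longrightarrow> \<exists>k. d = (rot ^^ k) (Up (vt d) 0)"
proof (cases d)
  case (Up v i)
  assume "dvalid d"
  then show ?thesis using Up rot_Up_pow[of i 0 v] by (intro exI[of _ i]) auto
next
  case (Hr v)
  assume "dvalid d"
  then show ?thesis using Hr rot_Up_deg[of v] by (intro exI[of _ "deg v"]) (auto simp: rlast_def)
next
  case (Hl v)
  assume "dvalid d"
  then show ?thesis using Hl rot_orbit_parts(2)[of v]
    by (intro exI[of _ "np v + (hz (rg v) + deg v)"]) (auto simp: lfirst_def)
next
  case (Dn p i)
  assume "dvalid d"
  then have p: "valid p" "i < deg p" using Dn by auto
  have v: "valid (child p i)" using valid_child[OF p] .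
  show ?thesis
  proof (cases "i = 0 \<and> lg p = K")
    case True
    then have "np (child p i) = 2" "rdown (child p i) = d"
      using Dn p prv_props[OF p(1)] deg_pos[of "prv p"]
      by (auto simp: child_def typ_Cons)
    then show ?thesis using Dn rot_orbit_parts(1)[OF v]
      by (intro exI[of _ "hz (rg (child p i)) + deg (child p i)"]) auto
  next
    case ch: False
    show ?thesis
    proof (cases "Suc i = deg p \<and> rg p = K")
      case True
      then have "rot (rdown (child p i)) = d"
        using ch Dn p nxt_props[OF p(1)] deg_pos[OF p(1)]
        by (auto simp: child_def typ_Cons)
      then show ?thesis using Dn rot_orbit_parts(1)[OF v]
        by (intro exI[of _ "Suc (hz (rg (child p i)) + deg (child p i))"]) auto
    next
      case False
      then have "rdown (child p i) = d"
        using ch Dn p by (auto simp: child_def typ_Cons)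
      then show ?thesis using Dn rot_orbit_parts(1)[OF v]
        by (intro exI[of _ "hz (rg (child p i)) + deg (child p i)"]) auto
    qed
  qed
qed

lemma rot_pow_l: "dvalid d \<Longrightarrow> (rot ^^ l) d = d"
proof -
  assume d: "dvalid d"
  then obtain k where k: "d = (rot ^^ k) (Up (vt d) 0)" using rot_transitive by blast
  have v: "valid (vt d)" using d by (cases d) (auto simp: valid_child)
  have "(rot ^^ l) d = (rot ^^ k) ((rot ^^ l) (Up (vt d) 0))"
    by (subst k) (metis add.commute comp_apply funpow_add)
  then show ?thesis using rot_orbit_parts(3)[OF v] k by simp
qed

section \<open>Faces and universality\<close>

text \<open>Iterating \<open>turn\<close> walks round the face to the left of a dart; inside a gap
  it goes down the left side and up the right side.\<close>

definition turn :: "dart \<Rightarrow> dart" where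
  "turn d = rot (flip d)"

lemma turn_last: "valid v \<Longrightarrow> turn (Dn v (deg v - 1)) = rlast v"
  using deg_pos[of v] by (simp add: turn_def)

lemma funpow_2_Suc: "(f ^^ (2 * Suc n)) x = f ((f ^^ (2 * n)) (f x))"
  by (simp add: funpow_swap1)

text \<open>The last child prolongs the left side of the gap to the right of \<open>v\<close> by one
  edge, so the walk from it passes through \<open>rlast v\<close>. This is the induction step of the
  face arguments.\<close>

lemma last_child:
  assumes "valid v" "rg v \<noteq> K"
  defines "u \<equiv> (deg v - 1) # v"
  shows "valid u" "rg u = Suc (rg v)" "rdown u = Dn v (deg v - 1)" "nxt u = 0 # nxt v"
    "lg (nxt u) = Suc (rg v)" "turn (rdown u) = rlast v"
proof -
  have d: "deg v > 0" "lg v = K \<Longrightarrow> deg v \<ge> 2" using deg_pos deg_ge2 assms(1) by auto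
  show v: "valid u" using assms(1) d unfolding u_def by auto
  show r: "rg u = Suc (rg v)" using d assms unfolding u_def by (auto simp: typ_Cons)
  show rd: "rdown u = Dn v (deg v - 1)" using d assms unfolding u_def by (auto simp: typ_Cons)
  show "nxt u = 0 # nxt v" using d assms unfolding u_def by auto
  show "lg (nxt u) = Suc (rg v)" using nxt_props[OF v] r by simp
  show "turn (rdown u) = rlast v" unfolding rd using turn_last assms(1) .
qed

lemma turn_Up0:
  assumes "valid v" "lg v \<noteq> K"
  shows "turn (Up v 0) = lfirst (0 # v)"
  using assms by (simp add: turn_def)

lemma w_le_K: "odd_face \<Longrightarrow> w \<le> K"
  using K_eq w1 by auto

text \<open>Either side of the gap has as many edges down to the bottom vertex as its height says.
  For odd \<open>m\<close> the bound by \<open>w\<close> ensures that the walk traverses no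
  horizontal edge.\<close>

lemma face_below:
  "valid v \<Longrightarrow> rg v \<le> w \<or> \<not> odd_face \<Longrightarrow> (turn ^^ (2 * rg v)) (rdown v) = lfirst (nxt v)"
proof (induction v)
  case Nil
  then show ?case using w1 by (simp add: lfirst_def)
next
  case (Cons i v)
  then have v: "valid v" "i < deg v" "\<not> (i = 0 \<and> lg v = K)" by auto
  note nx = nxt_props[OF v(1)]
  consider "Suc i = deg v" "rg v = K" | "Suc i < deg v" | "Suc i = deg v" "rg v \<noteq> K"
    using v(2) by linarith
  then show ?case
  proof cases
    case 1
    have "deg (nxt v) \<ge> 2" using deg_ge2 nx 1 by simp
    then show ?thesis using 1 nx by (simp add: typ_Cons turn_def eval_nat_numeral)
  next
    case 2
    then show ?thesis using v by (simp add: typ_Cons turn_def eval_nat_numeral)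
  next
    case 3
    have i: "i = deg v - 1" using 3 by simp
    note lc = last_child[OF v(1) 3(2), folded i]
    have h: "odd_face \<Longrightarrow> rg v < w" using Cons.prems lc(2) by auto
    have rl: "rlast v = rdown v" using h by (auto simp: rlast_def)
    have lf: "lfirst (nxt v) = Up (nxt v) 0" using h nx by (auto simp: lfirst_def)
    have "(turn ^^ (2 * rg (i # v))) (rdown (i # v)) = turn ((turn ^^ (2 * rg v)) (rdown v))"
      unfolding lc(2) funpow_2_Suc lc(6) rl ..
    also have "\<dots> = turn (Up (nxt v) 0)"
      using Cons.IH[OF v(1)] h lf less_imp_le by metis
    also have "\<dots> = lfirst (0 # nxt v)" using turn_Up0 nx 3 by simp
    finally show ?thesis using lc(4) by simp
  qed
qed

text \<open>Above a horizontal edge a second face fills the gap: \<open>j\<close> edges down, the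
  horizontal edge, \<open>j\<close> edges up.\<close>

lemma face_above:
  "valid v \<Longrightarrow> odd_face \<Longrightarrow> rg v = w + j \<Longrightarrow> (turn ^^ (2 * j + 1)) (rlast v) = Up (nxt v) 0"
proof (induction j arbitrary: v)
  case 0
  then show ?case by (simp add: rlast_def turn_def)
next
  case (Suc j)
  obtain i p where v: "v = i # p" using Suc.prems w1 by (cases v) auto
  have p: "valid p" "i < deg p" using Suc.prems v by auto
  have i: "i = deg p - 1" "rg p \<noteq> K" "rg p = w + j"
    using Suc.prems v p w1 by (auto simp: typ_Cons split: if_splits)
  note lc = last_child[OF p(1) i(2), folded i(1) v]
  have rl: "rlast v = rdown v" using Suc.prems by (auto simp: rlast_def)
  have "(turn ^^ (2 * Suc j + 1)) (rlast v) = turn ((turn ^^ (2 * j + 1)) (turn (rdown v)))"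
    using rl by (simp add: funpow_swap1)
  also have "\<dots> = turn (Up (nxt p) 0)" using Suc.IH[OF p(1) Suc.prems(2) i(3)] lc(6) by simp
  also have "\<dots> = lfirst (nxt v)" using turn_Up0[of "nxt p"] nxt_props[OF p(1)] i(2) lc(4) by simp
  also have "\<dots> = Up (nxt v) 0" using lc(5) i(3) by (simp add: lfirst_def)
  finally show ?case .
qed

text \<open>For either parity a gap of full height has \<open>m - 2\<close> edges below; the two
  edges to the shared child complete the \<open>m\<close>-gon.\<close>

lemma face_top:
  assumes "valid v" "rg v = K"
  shows "(turn ^^ (m - 2)) (rlast v) = Up (nxt v) 0"
proof (cases odd_face)
  case True
  have "rg v = w + (w - 1)" "m - 2 = 2 * (w - 1) + 1" using assms(2) True K_eq m_eq w1 by auto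
  then show ?thesis using face_above[OF assms(1) True] by simp
next
  case False
  have "m - 2 = 2 * rg v" using False K_eq m_eq assms by simp
  then show ?thesis using face_below[OF assms(1)] False by (simp add: rlast_def lfirst_def)
qed

lemma turn_top:
  assumes "valid v" "rg v = K"
  shows "turn (Up (nxt v) 0) = Dn v (deg v - 1)"
  using nxt_props[OF assms(1)] assms by (simp add: turn_def)

lemma turn_fixed: "(turn ^^ m) d = d \<Longrightarrow> (turn ^^ m) ((turn ^^ k) d) = (turn ^^ k) d"
  by (metis add.commute comp_apply funpow_add)

lemma turn_fixed1: "(turn ^^ m) d = d \<Longrightarrow> (turn ^^ m) (turn d) = turn d"
  by (metis funpow_swap1)

text \<open>The induction climbs the left side of the gap to height \<open>K\<close>, where the
  shared child closes the face. If a walk returns to one dart, it returns to all later ones, so the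
  claim passes down again.\<close>

lemma face_closes_rlast:
  "valid v \<Longrightarrow> rg v \<le> K \<Longrightarrow> odd_face \<longrightarrow> w \<le> rg v \<Longrightarrow> (turn ^^ m) (rlast v) = rlast v"
proof (induction "K - rg v" arbitrary: v)
  case 0
  then have K: "rg v = K" by simp
  have "m = Suc (Suc (m - 2))" using m3 by simp
  then have "(turn ^^ m) (rlast v) = turn (turn ((turn ^^ (m - 2)) (rlast v)))"
    by (metis funpow.simps(2) comp_apply)
  then show ?case using face_top[OF 0(2) K] turn_top[OF 0(2) K] turn_last[OF 0(2)] by simp
next
  case (Suc n)
  then have "rg v \<noteq> K" by auto
  note lc = last_child[OF Suc.prems(1) this]
  let ?u = "(deg v - 1) # v"
  have "rlast ?u = rdown ?u" using lc(2) Suc.prems(3) by (auto simp: rlast_def)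
  moreover have "(turn ^^ m) (rlast ?u) = rlast ?u"
    using Suc.hyps(1)[of ?u] Suc.hyps(2) Suc.prems lc by auto
  ultimately show ?case using lc(6) turn_fixed1 by metis
qed

text \<open>In the lower face of a gap for odd \<open>m\<close> the climb ends at height
  \<open>w\<close>, where the horizontal edge closes the face.\<close>

lemma face_closes_rdown_low:
  "valid v \<Longrightarrow> odd_face \<Longrightarrow> rg v \<le> w \<Longrightarrow> (turn ^^ m) (rdown v) = rdown v"
proof (induction "w - rg v" arbitrary: v)
  case 0
  then have "rg v = w" by simp
  then have "(turn ^^ (2 * w)) (rdown v) = Hl (nxt v)"
    using face_below[of v] 0 nxt_props[of v] by (simp add: lfirst_def)
  moreover have "turn (Hl (nxt v)) = rdown v" using 0 nxt_props[of v] by (simp add: turn_def)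
  moreover have "m = Suc (2 * w)" using m_eq 0 by simp
  ultimately show ?case by (metis comp_apply funpow.simps(2))
next
  case (Suc n)
  have "rg v \<noteq> K" using Suc w_le_K by auto
  note lc = last_child[OF Suc.prems(1) this]
  let ?u = "(deg v - 1) # v"
  have "rlast v = rdown v" using Suc by (auto simp: rlast_def)
  moreover have "(turn ^^ m) (rdown ?u) = rdown ?u"
    using Suc.hyps(1)[of ?u] Suc.hyps(2) Suc.prems lc by auto
  ultimately show ?case using lc(6) turn_fixed1 by metis
qed

lemma rg_le_K: "valid v \<Longrightarrow> rg v \<le> K"
  using typ_invariant[of v] by (cases "v = []") auto

lemma face_closes_rdown: "valid v \<Longrightarrow> (turn ^^ m) (rdown v) = rdown v"
  using face_closes_rlast[of v] face_closes_rdown_low[of v] rg_le_K[of v]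
  by (cases "odd_face \<and> rg v \<le> w") (auto simp: rlast_def split: if_splits)

lemma face_closes_rlast': "valid v \<Longrightarrow> (turn ^^ m) (rlast v) = rlast v"
  using face_closes_rlast[of v] face_closes_rdown[of v] rg_le_K[of v]
  by (cases "odd_face \<and> rg v < w") (auto simp: rlast_def split: if_splits)

lemma rdown_child:
  assumes "valid p" "i < deg p" "\<not> (Suc i = deg p \<and> rg p = K)"
  shows "rdown (child p i) = Dn p i"
  using assms prv_props[OF assms(1)] deg_pos[of "prv p"]
  by (auto simp: child_def typ_Cons)

text \<open>Every dart is reached by \<open>turn\<close> from some \<open>rdown\<close> or
  \<open>rlast\<close> dart, for which the walk is known to close.\<close>

lemma turn_pow_m: "dvalid d \<Longrightarrow> (turn ^^ m) d = d"
proof -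
  have down: "(turn ^^ m) (Dn p i) = Dn p i" if p: "valid p" "i < deg p" for p i
  proof (cases "Suc i = deg p \<and> rg p = K")
    case True
    then have i: "i = deg p - 1" by arith
    have "Dn p i = turn ((turn ^^ (m - 2)) (rlast p))"
      using True p face_top turn_top i by simp
    then show ?thesis using turn_fixed turn_fixed1 face_closes_rlast'[OF p(1)] by metis
  next
    case False
    then show ?thesis using rdown_child[OF p] face_closes_rdown[OF valid_child[OF p]] by simp
  qed
  have Up0: "(turn ^^ m) (Up v 0) = Up v 0" if v: "valid v" for v
  proof -
    define u where "u = prv v"
    have u: "valid u" "rg u = lg v" "nxt u = v" using prv_props[OF v] by (auto simp: u_def)
    show ?thesis
    proof (cases "odd_face \<and> w \<le> rg u")
      case True
      then obtain j where "rg u = w + j" using le_Suc_ex by blast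
      then have "(turn ^^ (2 * j + 1)) (rlast u) = Up v 0" using face_above u True by simp
      then show ?thesis using turn_fixed face_closes_rlast'[OF u(1)] by metis
    next
      case False
      then have "(turn ^^ (2 * rg u)) (rdown u) = Up v 0"
        using face_below[of u] u by (auto simp: lfirst_def)
      then show ?thesis using turn_fixed face_closes_rdown[OF u(1)] by metis
    qed
  qed
  assume d: "dvalid d"
  show "(turn ^^ m) d = d"
  proof (cases d)
    case (Up v i)
    show ?thesis
    proof (cases i)
      case 0
      then show ?thesis using Up d Up0 by simp
    next
      case (Suc j)
      then have j: "valid v" "j < deg v" "d = turn (Dn v j)" using Up d by (simp_all add: turn_def)
      show ?thesis unfolding j(3) using turn_fixed1[OF down[OF j(1,2)]] .
    qed
  next
    case (Dn v i)
    then show ?thesis using d down by simp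
  next
    case (Hr v)
    then show ?thesis using d face_closes_rlast'[of v] by (simp add: rlast_def)
  next
    case (Hl v)
    then have v: "valid v" "odd_face" "lg v = w" using d by auto
    define u where "u = prv v"
    have u: "valid u" "rg u = lg v" "nxt u = v" using prv_props[OF v(1)] by (auto simp: u_def)
    then have "(turn ^^ (2 * rg u)) (rdown u) = d"
      using face_below[of u] v Hl by (auto simp: lfirst_def)
    then show ?thesis using turn_fixed face_closes_rdown[OF u(1)] by metis
  qed
qed

end

text \<open>The dart set is initial among pointed sets with two permutations satisfying the relations.\<close>

locale layers_action = layers +
  fixes \<sigma> \<tau> :: "'x \<Rightarrow> 'x" and x0 :: 'x
  assumes \<sigma>_l: "(\<sigma> ^^ l) x = x" and \<tau>_\<tau>: "\<tau> (\<tau> x) = x"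
    and \<sigma>\<tau>_m: "((\<lambda>x. \<sigma> (\<tau> x)) ^^ m) x = x"
begin

section \<open>Images of darts in an arbitrary action\<close>

definition \<phi> :: "'x \<Rightarrow> 'x" where "\<phi> x = \<sigma> (\<tau> x)"

lemma \<phi>_m: "(\<phi> ^^ m) x = x"
  using \<sigma>\<tau>_m[of x] unfolding \<phi>_def[abs_def] .

lemma \<sigma>_inj: "\<sigma> x = \<sigma> y \<Longrightarrow> x = y"
proof -
  assume "\<sigma> x = \<sigma> y"
  then have "(\<sigma> ^^ (l - 1)) (\<sigma> x) = (\<sigma> ^^ (l - 1)) (\<sigma> y)" by simp
  moreover have "(\<sigma> ^^ (l - 1)) (\<sigma> z) = z" for z
  proof -
    have "l = Suc (l - 1)" using l3 by simp
    then have "(\<sigma> ^^ Suc (l - 1)) z = z" using \<sigma>_l[of z] by metis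
    then show ?thesis by (simp only: funpow_Suc_right comp_apply)
  qed
  ultimately show "x = y" by simp
qed

text \<open>The points \<open>pos v\<close>, \<open>ypos v\<close>, \<open>rpos v\<close> and \<open>zpos v\<close> are going to be the images of the darts
\<open>Up v 0\<close>, \<open>lfirst v\<close>, \<open>rlast v\<close> and \<open>rdown v\<close>.\<close>

fun pos :: "nat list \<Rightarrow> 'x" where
  "pos [] = x0"
| "pos (i # v) = (\<sigma> ^^ (1 + hz (lg (i # v)))) (\<tau> ((\<sigma> ^^ i) (pos v)))"

fun ypos :: "nat list \<Rightarrow> 'x" where
  "ypos [] = x0"
| "ypos (i # v) = \<phi> ((\<sigma> ^^ i) (pos v))"

definition rpos :: "nat list \<Rightarrow> 'x" where
  "rpos v = (\<sigma> ^^ deg v) (pos v)"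

definition zpos :: "nat list \<Rightarrow> 'x" where
  "zpos v = (\<sigma> ^^ hz (rg v)) (rpos v)"

lemma pos_ypos: "pos v = (\<sigma> ^^ hz (lg v)) (ypos v)"
  by (cases v) (simp_all add: \<phi>_def funpow_swap1)

text \<open>\<open>pos\<close> enters the vertex by the edge from the parent in its code; as
  \<open>\<sigma> ^^ l\<close> is trivial, completing the rotation returns to that edge. With two
  parents it comes one step after the rightmost descending edge.\<close>

lemma zpos_Cons:
  assumes "valid (i # v)"
  shows "(\<sigma> ^^ (np (i # v) - 1)) (zpos (i # v)) = \<tau> ((\<sigma> ^^ i) (pos v))"
proof -
  let ?u = "i # v"
  have "np ?u \<ge> 1" by (simp add: typ_Cons)
  then have l: "l = (np ?u - 1) + (hz (rg ?u) + (deg ?u + (1 + hz (lg ?u))))"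
    using np_sum[OF assms] by simp
  have "(\<sigma> ^^ (np ?u - 1)) (zpos ?u)
     = (\<sigma> ^^ ((np ?u - 1) + (hz (rg ?u) + (deg ?u + (1 + hz (lg ?u)))))) (\<tau> ((\<sigma> ^^ i) (pos v)))"
    unfolding zpos_def rpos_def pos.simps funpow_add comp_apply ..
  then show ?thesis using \<sigma>_l l by metis
qed

lemma zpos_Nil: "zpos [] = x0"
  by (simp add: zpos_def rpos_def \<sigma>_l)

lemma rpos_step:
  assumes "deg v > 0"
  shows "\<phi> (\<tau> ((\<sigma> ^^ (deg v - 1)) (pos v))) = rpos v"
  using assms by (cases "deg v") (simp_all add: \<phi>_def \<tau>_\<tau> rpos_def)

lemma zpos_last:
  assumes "valid v" "rg v \<noteq> K"
  shows "zpos ((deg v - 1) # v) = \<tau> ((\<sigma> ^^ (deg v - 1)) (pos v))"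
    and "\<phi> (zpos ((deg v - 1) # v)) = rpos v"
proof -
  show 1: "zpos ((deg v - 1) # v) = \<tau> ((\<sigma> ^^ (deg v - 1)) (pos v))"
    using zpos_Cons[OF last_child(1)[OF assms]] assms by (simp add: typ_Cons)
  show "\<phi> (zpos ((deg v - 1) # v)) = rpos v"
    using 1 rpos_step deg_pos[OF assms(1)] by simp
qed

text \<open>One step leads from the right-hand side of the claim to \<open>rpos v\<close>, and
  \<open>m - 2\<close> more to \<open>pos (nxt v)\<close>; as \<open>\<phi> ^^ m\<close> is trivial,
  one further step closes the face.\<close>

lemma face_top_pos:
  assumes v: "valid v" "rg v = K"
    and A: "\<not> odd_face \<Longrightarrow> (\<phi> ^^ (2 * rg v)) (zpos v) = ypos (nxt v)"
    and B: "\<And>j. odd_face \<Longrightarrow> rg v = w + j \<Longrightarrow> (\<phi> ^^ (2 * j + 1)) (rpos v) = pos (nxt v)"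
  shows "\<phi> (pos (nxt v)) = \<tau> ((\<sigma> ^^ (deg v - 1)) (pos v))"
proof -
  have "(\<phi> ^^ (m - 2)) (rpos v) = pos (nxt v)"
  proof (cases odd_face)
    case True
    have "rg v = w + (w - 1)" "m - 2 = 2 * (w - 1) + 1" using v True K_eq m_eq w1 by auto
    then show ?thesis using B True by simp
  next
    case False
    have "m - 2 = 2 * rg v" using False K_eq m_eq v by simp
    then show ?thesis using A False by (simp add: pos_ypos[of "nxt v"] hz_def zpos_def)
  qed
  moreover have "Suc (Suc (m - 2)) = m" using m3 by simp
  moreover have "(\<phi> ^^ Suc (Suc (m - 2))) x = \<phi> ((\<phi> ^^ (m - 2)) (\<phi> x))" for x
    by (simp add: funpow_swap1)
  ultimately show ?thesis using \<phi>_m rpos_step[OF deg_pos[OF v(1)]] by metis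
qed

text \<open>\<open>pos v\<close> and \<open>pos (nxt v)\<close> are built along different descending
  paths, so their agreement across a gap has to come from the face relation. The claims treat the
  walk below, the walk over a horizontal edge, and the shared child. The last claim at a vertex
  enters the first one at its last child, hence the joint induction.\<close>

lemma faces_pos:
  assumes "valid v"
  shows "(rg v \<le> w \<or> \<not> odd_face \<longrightarrow> (\<phi> ^^ (2 * rg v)) (zpos v) = ypos (nxt v)) \<and>
    (\<forall>j. odd_face \<longrightarrow> rg v = w + j \<longrightarrow> (\<phi> ^^ (2 * j + 1)) (rpos v) = pos (nxt v)) \<and>
    (rg v = K \<longrightarrow> \<phi> (pos (nxt v)) = \<tau> ((\<sigma> ^^ (deg v - 1)) (pos v)))"
  using assms
proof (induction v)
  case Nil
  then show ?case using w1 K1 by (simp add: zpos_Nil)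
next
  case (Cons i v)
  then have v: "valid v" "i < deg v" "\<not> (i = 0 \<and> lg v = K)" by auto
  have IHA: "rg v \<le> w \<or> \<not> odd_face \<Longrightarrow> (\<phi> ^^ (2 * rg v)) (zpos v) = ypos (nxt v)"
    and IHB: "\<And>j. odd_face \<Longrightarrow> rg v = w + j \<Longrightarrow> (\<phi> ^^ (2 * j + 1)) (rpos v) = pos (nxt v)"
    and IHC: "rg v = K \<Longrightarrow> \<phi> (pos (nxt v)) = \<tau> ((\<sigma> ^^ (deg v - 1)) (pos v))"
    using Cons.IH v by blast+
  let ?u = "i # v"
  note nx = nxt_props[OF v(1)]
  have A: "(\<phi> ^^ (2 * rg ?u)) (zpos ?u) = ypos (nxt ?u)" if h: "rg ?u \<le> w \<or> \<not> odd_face"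
  proof -
    consider "Suc i = deg v" "rg v = K" | "Suc i < deg v" | "Suc i = deg v" "rg v \<noteq> K"
      using v(2) by linarith
    then show ?thesis
    proof cases
      case 1
      have i: "i = deg v - 1" using 1 by simp
      have "\<sigma> (zpos ?u) = \<tau> ((\<sigma> ^^ i) (pos v))"
        using zpos_Cons[OF Cons.prems] 1 by (simp add: typ_Cons)
      also have "\<dots> = \<phi> (pos (nxt v))" using IHC 1(2) i by simp
      finally have "zpos ?u = \<tau> (pos (nxt v))" unfolding \<phi>_def by (rule \<sigma>_inj)
      then show ?thesis using 1 by (simp add: typ_Cons eval_nat_numeral \<phi>_def \<tau>_\<tau>)
    next
      case 2
      have "zpos ?u = \<tau> ((\<sigma> ^^ i) (pos v))"
        using zpos_Cons[OF Cons.prems] 2 by (simp add: typ_Cons)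
      then show ?thesis using 2 by (simp add: typ_Cons eval_nat_numeral \<phi>_def \<tau>_\<tau>)
    next
      case 3
      have i: "i = deg v - 1" using 3 by simp
      note lc = last_child[OF v(1) 3(2), folded i]
      have lo: "odd_face \<Longrightarrow> rg v < w" using h lc(2) by auto
      have z: "zpos v = rpos v" using lo by (auto simp: zpos_def hz_def)
      have y: "pos (nxt v) = ypos (nxt v)" using lo nx pos_ypos[of "nxt v"] by (auto simp: hz_def)
      have "(\<phi> ^^ (2 * rg ?u)) (zpos ?u) = \<phi> ((\<phi> ^^ (2 * rg v)) (zpos v))"
        unfolding lc(2) funpow_2_Suc z using zpos_last(2)[OF v(1) 3(2)] i by simp
      then show ?thesis using IHA lo y lc(4) by fastforce
    qed
  qed
  have B: "(\<phi> ^^ (2 * j + 1)) (rpos ?u) = pos (nxt ?u)" if o: "odd_face" and h: "rg ?u = w + j" for j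
  proof (cases j)
    case 0
    then have hw: "rg ?u = w" using h by simp
    \<comment> \<open>The lower walk covers \<open>2 * w = m - 1\<close> edges, so the face relation
      supplies the remaining horizontal one.\<close>
    have "(\<phi> ^^ (2 * w)) (zpos ?u) = ypos (nxt ?u)" using A hw by simp
    moreover have "m = Suc (2 * w)" using m_eq o by simp
    ultimately have "(\<phi> ^^ m) (zpos ?u) = \<phi> (ypos (nxt ?u))" by (metis comp_apply funpow.simps(2))
    then have "zpos ?u = \<phi> (ypos (nxt ?u))" using \<phi>_m by simp
    moreover have "zpos ?u = \<sigma> (rpos ?u)" using o hw by (simp add: zpos_def hz_def)
    ultimately have "rpos ?u = \<tau> (ypos (nxt ?u))" by (metis \<phi>_def \<sigma>_inj)
    then have "\<phi> (rpos ?u) = \<sigma> (ypos (nxt ?u))" by (simp add: \<phi>_def \<tau>_\<tau>)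
    moreover have "pos (nxt ?u) = \<sigma> (ypos (nxt ?u))"
      using pos_ypos[of "nxt ?u"] nxt_props[OF Cons.prems] o hw by (simp add: hz_def)
    ultimately show ?thesis using 0 by simp
  next
    case (Suc k)
    have i: "i = deg v - 1" "rg v \<noteq> K" "rg v = w + k"
      using h Suc v w1 by (auto simp: typ_Cons split: if_splits)
    note lc = last_child[OF v(1) i(2), folded i(1)]
    have z: "zpos ?u = rpos ?u" using h Suc by (simp add: zpos_def hz_def)
    have "(\<phi> ^^ (2 * j + 1)) (rpos ?u) = \<phi> ((\<phi> ^^ (2 * k + 1)) (\<phi> (zpos ?u)))"
      using z Suc by (simp add: funpow_swap1)
    also have "\<dots> = \<phi> (pos (nxt v))"
      using zpos_last(2)[OF v(1) i(2)] IHB[OF o i(3)] i(1) by simp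
    also have "\<dots> = ypos (nxt ?u)" using lc(4) by simp
    also have "\<dots> = pos (nxt ?u)" using pos_ypos[of "nxt ?u"] lc(5) i(3) by (simp add: hz_def)
    finally show ?thesis .
  qed
  show ?case using A B face_top_pos[OF Cons.prems] by blast
qed

lemma merge_pos:
  "valid v \<Longrightarrow> rg v = K \<Longrightarrow> \<phi> (pos (nxt v)) = \<tau> ((\<sigma> ^^ (deg v - 1)) (pos v))"
  using faces_pos by blast

lemma horizontal_pos:
  assumes "valid v" "odd_face" "rg v = w"
  shows "\<tau> (rpos v) = ypos (nxt v)"
proof -
  have "\<forall>j. odd_face \<longrightarrow> rg v = w + j \<longrightarrow> (\<phi> ^^ (2 * j + 1)) (rpos v) = pos (nxt v)"
    using faces_pos[OF assms(1)] by blast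
  from this[rule_format, of 0] have "\<phi> (rpos v) = pos (nxt v)" using assms by simp
  also have "\<dots> = \<sigma> (ypos (nxt v))"
    using pos_ypos[of "nxt v"] nxt_props[OF assms(1)] assms by (simp add: hz_def)
  finally show ?thesis unfolding \<phi>_def by (rule \<sigma>_inj)
qed

fun dpos :: "dart \<Rightarrow> 'x" where
  "dpos (Up v i) = (\<sigma> ^^ i) (pos v)"
| "dpos (Dn v i) = \<tau> ((\<sigma> ^^ i) (pos v))"
| "dpos (Hr v) = rpos v"
| "dpos (Hl v) = \<tau> (rpos (prv v))"

lemma dpos_flip: "dvalid d \<Longrightarrow> dpos (flip d) = \<tau> (dpos d)"
  using nxt_props by (cases d) (auto simp: \<tau>_\<tau>)

lemma dpos_lfirst: "valid v \<Longrightarrow> dpos (lfirst v) = ypos v"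
  using horizontal_pos[of "prv v"] prv_props[of v] pos_ypos[of v]
  by (auto simp: lfirst_def hz_def)

lemma dpos_rdown: "valid v \<Longrightarrow> dpos (rdown v) = zpos v"
proof (cases v)
  case Nil
  then show ?thesis by (simp add: zpos_Nil)
next
  case (Cons i p)
  assume v: "valid v"
  show ?thesis
  proof (cases "Suc i = deg p \<and> rg p = K")
    case True
    then have i: "i = deg p - 1" by arith
    have "\<sigma> (zpos v) = \<tau> ((\<sigma> ^^ i) (pos p))"
      using zpos_Cons[of i p] v Cons True by (simp add: typ_Cons)
    also have "\<dots> = \<sigma> (\<tau> (pos (nxt p)))"
      using merge_pos[of p] v Cons True i by (simp add: \<phi>_def)
    finally have "zpos v = \<tau> (pos (nxt p))" by (rule \<sigma>_inj)
    then show ?thesis using Cons True by (simp add: typ_Cons)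
  next
    case False
    then show ?thesis using zpos_Cons[of i p] v Cons by (auto simp: typ_Cons)
  qed
qed

lemma dpos_rlast: "valid v \<Longrightarrow> dpos (rlast v) = rpos v"
  using dpos_rdown[of v] by (auto simp: rlast_def zpos_def hz_def)

text \<open>The face relation enters through \<open>merge_pos\<close> at a shared child and through
  \<open>horizontal_pos\<close> at a horizontal edge. Together with \<open>dpos_flip\<close> this is
  equivariance.\<close>

lemma dpos_rot: "dvalid d \<Longrightarrow> dpos (rot d) = \<sigma> (dpos d)"
proof (cases d)
  case (Up v i)
  assume "dvalid d"
  then show ?thesis using Up dpos_rlast[of v]
    by (cases "Suc i < deg v") (auto simp: rpos_def less_Suc_eq not_less_eq dest!: le_antisym)
next
  case (Hr v)
  assume "dvalid d"
  then show ?thesis using Hr dpos_rdown[of v] by (simp add: zpos_def hz_def)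
next
  case (Hl v)
  assume d: "dvalid d"
  then have v: "valid v" "odd_face" "lg v = w" using Hl by auto
  then show ?thesis using Hl horizontal_pos[of "prv v"] prv_props[of v] pos_ypos[of v]
    by (simp add: hz_def)
next
  case (Dn v i)
  assume d: "dvalid d"
  then have v: "valid v" "i < deg v" using Dn by auto
  show ?thesis
  proof (cases "i = 0 \<and> lg v = K")
    case True
    then show ?thesis using Dn merge_pos[of "prv v"] prv_props[OF v(1)] by (simp add: \<phi>_def)
  next
    case False
    then have "dpos (lfirst (i # v)) = ypos (i # v)" using v by (intro dpos_lfirst) auto
    then show ?thesis using Dn False by (auto simp: \<phi>_def)
  qed
qed

end

section \<open>The Coxeter group acts simply transitively on flags\<close>

lemma geq_context: "geq l m u v \<Longrightarrow> geq l m (a @ u @ b) (a @ v @ b)"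
proof (induction rule: geq.induct)
  case (geq_rel x u v)
  then show ?case using geq.geq_rel[OF geq_rel, of "a @ u" "v @ b"] by simp
qed (auto intro: geq.intros)

lemma geq_append: "geq l m u u' \<Longrightarrow> geq l m v v' \<Longrightarrow> geq l m (u @ v) (u' @ v')"
  using geq_context[of l m u u' "[]" v] geq_context[of l m v v' u' "[]"]
  by (auto intro: geq_trans)

lemma geq_square: "geq l m (a # a # v) v"
  using geq_rel[of l m "[a, a]" "[]" v] by (auto simp: coxrel_def)

lemma geq_face: "geq l m (concat (replicate m [R0, R1])) []"
  using geq_rel[of l m "concat (replicate m [R0, R1])" "[]" "[]"] by (auto simp: coxrel_def)

lemma geq_vertex: "geq l m (concat (replicate l [R1, R2])) []"
  using geq_rel[of l m "concat (replicate l [R1, R2])" "[]" "[]"] by (auto simp: coxrel_def)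

lemma geq_commute: "geq l m [R0, R2] [R2, R0]"
proof -
  have "geq l m ([] @ [R0, R2, R0, R2] @ [R2, R0]) ([] @ [R2, R0])"
    by (rule geq_rel) (simp add: coxrel_def)
  moreover have "geq l m ([R0, R2, R0] @ [R2, R2] @ [R0]) ([R0, R2, R0] @ [R0])"
    by (rule geq_rel) (simp add: coxrel_def)
  moreover have "geq l m ([R0, R2] @ [R0, R0] @ []) ([R0, R2] @ [])"
    by (rule geq_rel) (simp add: coxrel_def)
  ultimately show ?thesis by (metis append_Cons append_Nil append_Nil2 geq_sym geq_trans)
qed

text \<open>As \<open>R0\<close> and \<open>R2\<close> commute, \<open>R0 R2 R1 R2\<close> is the
  conjugate of \<open>R0 R1\<close> by \<open>R2\<close>. This yields the face relation for the
  rotations \<open>R1 R2\<close> and \<open>R0 R2\<close>.\<close>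

lemma geq_turn_power:
  "geq l m (concat (replicate n [R0, R2, R1, R2])) (R2 # concat (replicate n [R0, R1]) @ [R2])"
proof (induction n)
  case 0
  then show ?case using geq_square[of l m R2 "[]"] by (simp add: geq_sym)
next
  case (Suc n)
  let ?P = "concat (replicate n [R0, R1])"
  have "geq l m ([R0, R2, R1, R2] @ concat (replicate n [R0, R2, R1, R2]))
      (([R0, R2] @ [R1]) @ R2 # R2 # ?P @ [R2])"
    using geq_append[OF geq_refl Suc.IH, of "[R0, R2, R1, R2]"] by simp
  moreover have "geq l m (([R0, R2] @ [R1]) @ R2 # R2 # ?P @ [R2]) (([R2, R0] @ [R1]) @ ?P @ [R2])"
    by (intro geq_append geq_commute geq_square geq_refl)
  ultimately have "geq l m ([R0, R2, R1, R2] @ concat (replicate n [R0, R2, R1, R2]))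
     (([R2, R0] @ [R1]) @ ?P @ [R2])" by (rule geq_trans)
  then show ?case by simp
qed

section \<open>Word classes and their right action\<close>

definition cls :: "nat \<Rightarrow> nat \<Rightarrow> gen list \<Rightarrow> gen list set" where
  "cls l m u = {v. geq l m u v}"

lemma cls_eq_iff: "cls l m u = cls l m v \<longleftrightarrow> geq l m u v"
  by (auto simp: cls_def intro: geq_refl geq_sym geq_trans)

text \<open>Sets that are not classes are left fixed, so that the relations hold on the whole type.\<close>

definition cact :: "nat \<Rightarrow> nat \<Rightarrow> gen list \<Rightarrow> gen list set \<Rightarrow> gen list set" where
  "cact l m x C = (if C \<in> range (cls l m) then cls l m ((SOME u. C = cls l m u) @ x) else C)"

lemma cact_cls: "cact l m x (cls l m u) = cls l m (u @ x)"
proof -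
  define v where "v = (SOME v. cls l m u = cls l m v)"
  have "cls l m u = cls l m v" unfolding v_def by (rule someI[of _ u]) simp
  then have "geq l m v u" unfolding cls_eq_iff by (rule geq_sym)
  then have "cls l m (v @ x) = cls l m (u @ x)"
    unfolding cls_eq_iff by (rule geq_append[OF _ geq_refl])
  moreover have "cact l m x (cls l m u) = cls l m (v @ x)"
    unfolding cact_def v_def by (rule if_P) (rule rangeI)
  ultimately show ?thesis by (rule trans[rotated])
qed

lemma cact_other: "C \<notin> range (cls l m) \<Longrightarrow> cact l m x C = C"
  by (simp add: cact_def)

lemma cact_append: "cact l m x (cact l m y C) = cact l m (y @ x) C"
  by (cases "C \<in> range (cls l m)") (auto simp: cact_cls cact_other)

lemma cact_cong: "geq l m x y \<Longrightarrow> cact l m x C = cact l m y C"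
proof (cases "C \<in> range (cls l m)")
  assume "geq l m x y"
  moreover case True
  then obtain u where "C = cls l m u" by blast
  moreover have "geq l m (u @ x) (u @ y)" using calculation(1) by (rule geq_append[OF geq_refl])
  ultimately show ?thesis by (simp only: cact_cls cls_eq_iff)
qed (simp add: cact_other)

lemma cact_Nil: "cact l m [] C = C"
  by (cases "C \<in> range (cls l m)") (auto simp: cact_cls cact_other)

lemma cact_power: "(cact l m x ^^ n) C = cact l m (concat (replicate n x)) C"
proof (induction n arbitrary: C)
  case (Suc n)
  then show ?case by (simp add: funpow_Suc_right cact_append del: funpow.simps)
qed (simp add: cact_Nil)

context layers begin

lemma words_action:
  "layers_action l m (cact l m [R1, R2]) (cact l m [R0, R2])"
proof unfold_locales
  fix C
  show "(cact l m [R1, R2] ^^ l) C = C"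
    unfolding cact_power cact_cong[OF geq_vertex] cact_Nil ..
  have "geq l m [R0, R2, R0, R2] []" using geq_rel[of l m "[R0, R2, R0, R2]" "[]" "[]"] by (simp add: coxrel_def)
  from cact_cong[OF this] show "cact l m [R0, R2] (cact l m [R0, R2] C) = C"
    by (simp add: cact_append cact_Nil)
  have "geq l m (R2 # concat (replicate m [R0, R1]) @ [R2]) [R2, R2]"
    using geq_context[OF geq_face[of l m], of "[R2]" "[R2]"] by simp
  then have "geq l m (concat (replicate m [R0, R2, R1, R2])) []"
    using geq_square[of l m R2 "[]"] geq_turn_power geq_trans by blast
  from cact_cong[OF this] show "((\<lambda>C. cact l m [R1, R2] (cact l m [R0, R2] C)) ^^ m) C = C"
    unfolding cact_append append.simps by (simp add: cact_power cact_Nil)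
qed

section \<open>Flags and the reflections acting on them\<close>

lemma rot_pow_valid: "dvalid d \<Longrightarrow> dvalid ((rot ^^ k) d) \<and> vt ((rot ^^ k) d) = vt d"
  by (induction k) (auto simp: rot_valid)

definition tor :: "dart \<Rightarrow> dart" where "tor = rot ^^ (l - 1)"

lemma tor_valid: "dvalid d \<Longrightarrow> dvalid (tor d) \<and> vt (tor d) = vt d"
  by (simp add: tor_def rot_pow_valid)

lemma rot_tor: "dvalid d \<Longrightarrow> rot (tor d) = d" "dvalid d \<Longrightarrow> tor (rot d) = d"
proof -
  assume d: "dvalid d"
  have "Suc (l - 1) = l" using l3 by simp
  then have "(rot ^^ Suc (l - 1)) d = d" using rot_pow_l[OF d] by metis
  then show "rot (tor d) = d" "tor (rot d) = d" by (simp_all add: tor_def funpow_swap1)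
qed

text \<open>The flag \<open>(d, b)\<close> is the dart \<open>d\<close> together with one of its two sides.  \<open>R1\<close> rotates in
opposite directions on the two sides, which makes it an involution.\<close>

fun step :: "gen \<Rightarrow> dart \<times> bool \<Rightarrow> dart \<times> bool" where
  "step R0 (d, b) = (flip d, \<not> b)"
| "step R1 (d, b) = (if b then rot d else tor d, \<not> b)"
| "step R2 (d, b) = (d, \<not> b)"

lemma step_valid: "dvalid (fst f) \<Longrightarrow> dvalid (fst (step a f))"
  by (cases "(a, f)" rule: step.cases) (auto simp: flip_valid rot_valid tor_valid)

lemma step_step: "dvalid (fst f) \<Longrightarrow> step a (step a f) = f"
  by (cases "(a, f)" rule: step.cases) (auto simp: flip_flip rot_tor)

lemma fold_step_valid: "dvalid (fst f) \<Longrightarrow> dvalid (fst (fold step u f))"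
  by (induction u arbitrary: f) (auto simp: step_valid)

lemma fold_step_rev: "dvalid (fst f) \<Longrightarrow> fold step (rev u) (fold step u f) = f"
  by (induction u arbitrary: f) (auto simp: step_valid step_step)

text \<open>\<open>R0\<close> switches sides before \<open>R1\<close> acts, so on side
  \<open>False\<close> the word \<open>R0 R1\<close> rotates forwards and is \<open>turn\<close>; on
  side \<open>True\<close> it rotates backwards.\<close>

lemma fold_face_False: "fold step (concat (replicate n [R0, R1])) (d, False) = ((turn ^^ n) d, False)"
  by (induction n arbitrary: d) (auto simp: turn_def funpow_swap1)

lemma fold_face_True:
  "fold step (concat (replicate n [R0, R1])) (d, True) = (((\<lambda>x. tor (flip x)) ^^ n) d, True)"
  by (induction n arbitrary: d) (auto simp: funpow_Suc_right simp del: funpow.simps(2))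

lemma fold_vertex:
  "fold step (concat (replicate n [R1, R2])) (d, b) = (((if b then rot else tor) ^^ n) d, b)"
  by (induction n arbitrary: d) (auto simp: funpow_swap1)

lemma tor_flip_pow_valid: "dvalid d \<Longrightarrow> dvalid (((\<lambda>x. tor (flip x)) ^^ n) d)"
  by (induction n) (auto simp: tor_valid flip_valid)

text \<open>\<open>tor\<close> after \<open>flip\<close> is the inverse of \<open>turn\<close>
  conjugated by \<open>flip\<close>, and so inherits the period \<open>m\<close>.\<close>

lemma turn_inverse:
  "dvalid d \<Longrightarrow> (turn ^^ n) (flip (((\<lambda>x. tor (flip x)) ^^ n) d)) = flip d"
proof (induction n)
  case (Suc n)
  let ?x = "((\<lambda>x. tor (flip x)) ^^ n) d"
  have x: "dvalid ?x" by (rule tor_flip_pow_valid[OF Suc.prems])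
  have "turn (flip (tor (flip ?x))) = flip ?x"
    using x by (simp add: turn_def flip_flip flip_valid tor_valid rot_tor)
  then show ?case using Suc by (simp add: funpow_swap1)
qed simp

lemma tor_flip_pow_m: "dvalid d \<Longrightarrow> ((\<lambda>x. tor (flip x)) ^^ m) d = d"
  using turn_inverse[of d m] turn_pow_m[OF flip_valid[OF tor_flip_pow_valid[of d m]]]
    flip_flip[of d] flip_flip[OF tor_flip_pow_valid[of d m]] by simp

lemma tor_pow_l: "dvalid d \<Longrightarrow> (tor ^^ l) d = d"
proof -
  assume d: "dvalid d"
  have "((rot ^^ l) ^^ k) d = d" for k by (induction k) (auto simp: rot_pow_l d)
  from this[of "l - 1"] show ?thesis by (simp add: tor_def funpow_mult mult.commute)
qed

lemma fold_coxrel: "coxrel l m x \<Longrightarrow> dvalid (fst f) \<Longrightarrow> fold step x f = f"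
proof -
  assume x: "coxrel l m x" and f: "dvalid (fst f)"
  obtain d b where db: "f = (d, b)" by (cases f)
  then have d: "dvalid d" using f by simp
  consider a where "x = [a, a]" | "x = concat (replicate m [R0, R1])"
    | "x = concat (replicate l [R1, R2])" | "x = [R0, R2, R0, R2]"
    using x by (auto simp: coxrel_def)
  then show ?thesis
  proof cases
    case 1
    then show ?thesis using f step_step by simp
  next
    case 2
    then show ?thesis using db d
      by (cases b) (auto simp: fold_face_True fold_face_False tor_flip_pow_m turn_pow_m)
  next
    case 3
    then show ?thesis using db d by (cases b) (auto simp: fold_vertex rot_pow_l tor_pow_l)
  next
    case 4
    then show ?thesis using db d by (simp add: flip_flip)
  qed
qed

lemma geq_fold: "geq l m u v \<Longrightarrow> dvalid (fst f) \<Longrightarrow> fold step u f = fold step v f"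
proof (induction arbitrary: f rule: geq.induct)
  case (geq_rel x u v)
  then show ?case using fold_coxrel fold_step_valid by simp
qed auto

section \<open>The orbit of the base flag\<close>

definition run :: "gen list \<Rightarrow> dart \<times> bool" where
  "run u = fold step u (Up [] 0, True)"

lemma root_dart_valid: "dvalid (Up [] 0)"
  using l3 by simp

lemma run_valid: "dvalid (fst (run u))"
  unfolding run_def by (rule fold_step_valid) (use root_dart_valid in simp)

lemma run_append: "run (u @ v) = fold step v (run u)"
  by (simp add: run_def)

interpretation words: layers_action l m "cact l m [R1, R2]" "cact l m [R0, R2]" "cls l m []"
  by (rule words_action)

text \<open>Built to recover the class of \<open>u\<close> from \<open>run u\<close>; the two sides
  of a dart differ by the reflection \<open>R2\<close>.\<close>

definition flagcls :: "dart \<times> bool \<Rightarrow> gen list set" where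
  "flagcls f = (if snd f then words.dpos (fst f) else cact l m [R2] (words.dpos (fst f)))"

text \<open>Equivariance under the two rotations suffices, because \<open>R0\<close> and
  \<open>R1\<close> are products of a rotation with \<open>R2\<close>.\<close>

lemma flagcls_step:
  assumes "dvalid (fst f)"
  shows "flagcls (step a f) = cact l m [a] (flagcls f)"
proof -
  obtain d b where f: "f = (d, b)" by (cases f)
  then have d: "dvalid d" using assms by simp
  have sq: "cact l m (x @ [g, g] @ y) C = cact l m (x @ y) C" for g x y C
    by (intro cact_cong geq_rel) (simp add: coxrel_def)
  show ?thesis
  proof (cases a)
    case R0
    have "cact l m [R0, R2] (words.dpos d) = cact l m [R2, R0] (words.dpos d)"
      by (rule cact_cong[OF geq_commute])
    moreover have "cact l m [R2] (cact l m [R0, R2] (words.dpos d)) = cact l m [R0] (words.dpos d)"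
      using sq[of "[R0]" R2 "[]"] by (simp add: cact_append)
    ultimately show ?thesis
      using R0 f words.dpos_flip[OF d] by (cases b) (simp_all add: flagcls_def cact_append)
  next
    case R1
    have "words.dpos d = cact l m [R1, R2] (words.dpos (tor d))"
      using words.dpos_rot[of "tor d"] tor_valid[OF d] rot_tor[OF d] by simp
    then have "cact l m [R1] (cact l m [R2] (words.dpos d)) = words.dpos (tor d)"
      using sq[of "[R1]" R2 "[R1]"] sq[of "[]" R1 "[]"] by (simp add: cact_append cact_Nil)
    moreover have "cact l m [R2] (words.dpos (rot d)) = cact l m [R1] (words.dpos d)"
      using words.dpos_rot[OF d] sq[of "[R1]" R2 "[]"] by (simp add: cact_append)
    ultimately show ?thesis using R1 f by (cases b) (simp_all add: flagcls_def)
  next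
    case R2
    then show ?thesis using f sq[of "[]" gen.R2 "[]"] by (simp add: flagcls_def cact_append cact_Nil)
  qed
qed

lemma flagcls_run: "flagcls (run u) = cls l m u"
proof (induction u rule: rev_induct)
  case Nil
  then show ?case by (simp add: run_def flagcls_def)
next
  case (snoc a u)
  then show ?case using flagcls_step[OF run_valid, of a u] by (simp add: run_append cact_cls)
qed

text \<open>The relations act trivially on flags, and conversely \<open>flagcls\<close> recovers the
  class of a word from the flag it reaches. So the action is free on the orbit of the base
  flag.\<close>

lemma geq_iff_run: "geq l m u v \<longleftrightarrow> run u = run v"
  using geq_fold[of u v "(Up [] 0, True)"] root_dart_valid flagcls_run cls_eq_iff
  by (metis fst_conv run_def)

section \<open>Vertices as cosets, and their adjacency\<close>

definition vert :: "gen list \<Rightarrow> nat list" where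
  "vert u = vt (fst (run u))"

lemma fold_stabiliser:
  "set h \<subseteq> {R1, R2} \<Longrightarrow> dvalid (fst f) \<Longrightarrow> vt (fst (fold step h f)) = vt (fst f)"
proof (induction h arbitrary: f)
  case (Cons a h)
  have "vt (fst (step a f)) = vt (fst f)"
    using Cons.prems by (cases "(a, f)" rule: step.cases) (auto simp: rot_valid tor_valid)
  then show ?case using Cons step_valid by simp
qed simp

lemma stabiliser_reaches:
  assumes "dvalid (fst f)"
  obtains h where "set h \<subseteq> {R1, R2}" "fold step h (Up (vt (fst f)) 0, True) = f"
proof -
  obtain d b where f: "f = (d, b)" by (cases f)
  then obtain k where k: "d = (rot ^^ k) (Up (vt d) 0)" using rot_transitive assms by auto
  let ?h = "concat (replicate k [R1, R2]) @ (if b then [] else [R2])"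
  have "set ?h \<subseteq> {R1, R2}" by auto
  moreover have "fold step ?h (Up (vt (fst f)) 0, True) = f"
    using k f by (simp add: fold_vertex)
  ultimately show ?thesis by (rule that)
qed

lemma vt_valid: "dvalid d \<Longrightarrow> valid (vt d)"
  by (cases d) (auto simp: valid_child)

lemma stabiliser_transitive:
  assumes "dvalid (fst f)" "dvalid (fst g)" "vt (fst f) = vt (fst g)"
  obtains h where "set h \<subseteq> {R1, R2}" "fold step h g = f"
proof -
  have U: "dvalid (fst (Up (vt (fst g)) 0, True))"
    using deg_pos[OF vt_valid[OF assms(2)]] vt_valid[OF assms(2)] by simp
  obtain a where a: "set a \<subseteq> {R1, R2}" "fold step a (Up (vt (fst f)) 0, True) = f"
    using stabiliser_reaches[OF assms(1)] .
  obtain b where b: "set b \<subseteq> {R1, R2}" "fold step b (Up (vt (fst g)) 0, True) = g"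
    using stabiliser_reaches[OF assms(2)] .
  have "fold step (rev b) g = (Up (vt (fst g)) 0, True)" using fold_step_rev[OF U, of b] b(2) by simp
  then show ?thesis using that[of "rev b @ a"] a b assms(3) by simp
qed

text \<open>The orbits of words in \<open>R1\<close> and \<open>R2\<close> are exactly the sets of
  flags at a common vertex; freeness turns this into a statement about cosets.\<close>

lemma coset_eq_iff: "coset_eq l m u v \<longleftrightarrow> vert u = vert v"
proof
  assume "coset_eq l m u v"
  then obtain h where "set h \<subseteq> {R1, R2}" "geq l m u (v @ h)" by (auto simp: coset_eq_def)
  then show "vert u = vert v"
    using fold_stabiliser[OF _ run_valid] by (simp add: geq_iff_run run_append vert_def)
next
  assume "vert u = vert v"
  then obtain h where "set h \<subseteq> {R1, R2}" "fold step h (run v) = run u"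
    using stabiliser_transitive[OF run_valid run_valid] unfolding vert_def by metis
  then show "coset_eq l m u v" by (auto simp: coset_eq_def geq_iff_run run_append)
qed

definition coset :: "nat list \<Rightarrow> gen list set" where
  "coset v = {u. vert u = v}"

lemma vclass_eq: "vclass l m u = coset (vert u)"
  by (simp add: vclass_def coset_def coset_eq_iff)

lemma reach_dart: "valid v \<Longrightarrow> \<exists>u. run u = (Up v 0, True)"
proof (induction v)
  case Nil
  then show ?case by (intro exI[of _ "[]"]) (simp add: run_def)
next
  case (Cons i p)
  then obtain u where u: "run u = (Up p 0, True)" by auto
  have d: "dvalid (fst (Up p i, True))" "vt (fst (Up p i, True)) = p" using Cons by auto
  obtain h where h: "fold step h (Up p 0, True) = (Up p i, True)"
    using stabiliser_reaches[OF d(1)] d(2) by auto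
  have e: "run (u @ h @ [R0]) = (Dn p i, False)" by (simp add: run_append u h)
  have "vt (Dn p i) = i # p" using Cons.prems by (auto simp: child_def)
  moreover have "dvalid (Up (i # p) 0)" using Cons.prems deg_pos[of "i # p"] by simp
  ultimately obtain h' where "fold step h' (Dn p i, False) = (Up (i # p) 0, True)"
    using stabiliser_transitive[of "(Up (i # p) 0, True)" "(Dn p i, False)"] d(1) by auto
  then have "run ((u @ h @ [R0]) @ h') = (Up (i # p) 0, True)" using e by (simp only: run_append)
  then show ?case by blast
qed

lemma reach_flag: "dvalid (fst f) \<Longrightarrow> \<exists>u. run u = f"
proof -
  assume f: "dvalid (fst f)"
  obtain u where u: "run u = (Up (vt (fst f)) 0, True)" using reach_dart[OF vt_valid[OF f]] by blast
  obtain h where "fold step h (Up (vt (fst f)) 0, True) = f" using stabiliser_reaches[OF f] .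
  then show ?thesis using u run_append by metis
qed

lemma vert_valid: "valid (vert u)"
  unfolding vert_def by (rule vt_valid[OF run_valid])

lemma verts_eq: "verts l m = coset ` {v. valid v}"
proof -
  have "\<exists>u. vert u = v" if "valid v" for v using reach_dart[OF that] by (auto simp: vert_def) (metis fst_conv vt.simps(1))
  then have "range vert = {v. valid v}" using vert_valid by auto
  moreover have "verts l m = coset ` range vert" by (auto simp: verts_def vclass_eq)
  ultimately show ?thesis by simp
qed

lemma base_eq: "base l m = coset []"
  by (simp add: base_def vclass_eq vert_def run_def)

lemma inj_coset: "inj_on coset {v. valid v}"
proof (rule inj_onI)
  fix x y assume x: "x \<in> {v. valid v}" and e: "coset x = coset y"
  obtain u where "run u = (Up x 0, True)" using reach_dart x by auto
  then have "u \<in> coset x" by (simp add: coset_def vert_def)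
  then have "u \<in> coset y" using e by simp
  then show "x = y" using \<open>u \<in> coset x\<close> by (simp add: coset_def)
qed

definition edge :: "nat list \<Rightarrow> nat list \<Rightarrow> bool" where
  "edge x y \<longleftrightarrow> (\<exists>d. dvalid d \<and> vt d = x \<and> vt (flip d) = y)"

lemma adj_coset_iff:
  assumes "valid x" "valid y"
  shows "adj l m (coset x) (coset y) \<longleftrightarrow> edge x y"
proof
  assume "adj l m (coset x) (coset y)"
  then obtain u where u: "coset x = coset (vert u)" "coset y = coset (vert (u @ [R0]))"
    by (auto simp: adj_def vclass_eq)
  then have xy: "x = vert u" "y = vert (u @ [R0])"
    using inj_onD[OF inj_coset u(1)] inj_onD[OF inj_coset u(2)] assms vert_valid by simp_all
  obtain d b where "run u = (d, b)" by (cases "run u")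
  then show "edge x y"
    using xy run_valid[of u] unfolding edge_def by (intro exI[of _ d]) (auto simp: vert_def run_append)
next
  assume "edge x y"
  then obtain d where d: "dvalid d" "vt d = x" "vt (flip d) = y" by (auto simp: edge_def)
  then obtain u where "run u = (d, True)" using reach_flag[of "(d, True)"] by auto
  then have "x = vert u" "y = vert (u @ [R0])" using d by (auto simp: vert_def run_append)
  then show "adj l m (coset x) (coset y)" by (auto simp: adj_def vclass_eq)
qed

lemma edge_valid: "edge x y \<Longrightarrow> valid x \<and> valid y"
  unfolding edge_def using vt_valid flip_valid by blast

lemma edge_cases:
  assumes "edge x y"
  obtains i where "valid x" "i < deg x" "y = child x i"
    | i where "valid y" "i < deg y" "x = child y i"
    | "length x = length y"
proof -
  obtain d where d: "dvalid d" "vt d = x" "vt (flip d) = y" using assms by (auto simp: edge_def)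
  then show ?thesis using that by (cases d) auto
qed

lemma edge_child: "valid x \<Longrightarrow> i < deg x \<Longrightarrow> edge x (child x i)"
  unfolding edge_def by (intro exI[of _ "Up x i"]) auto

end

section \<open>Counting ascending paths\<close>

lemma is_path_Cons:
  "is_path l m (A # p) \<longleftrightarrow> A \<in> verts l m \<and> (p = [] \<or> adj l m A (hd p) \<and> is_path l m p)"
proof (cases p)
  case Nil
  then show ?thesis by (simp add: is_path_def)
next
  case (Cons B q)
  have "(\<forall>i. Suc i < length (A # p) \<longrightarrow> adj l m ((A # p) ! i) ((A # p) ! Suc i)) \<longleftrightarrow>
    adj l m A (hd p) \<and> (\<forall>i. Suc i < length p \<longrightarrow> adj l m (p ! i) (p ! Suc i))"
    (is "?L \<longleftrightarrow> ?R")
  proof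
    assume L: ?L
    show ?R
      using L[rule_format, of 0] L[rule_format, of "Suc i" for i] Cons by auto
  next
    assume R: ?R
    show ?L
    proof (intro allI impI)
      fix i assume "Suc i < length (A # p)"
      then show "adj l m ((A # p) ! i) ((A # p) ! Suc i)" using R Cons by (cases i) auto
    qed
  qed
  then show ?thesis using Cons by (auto simp: is_path_def)
qed

context layers begin

section \<open>Paths, distance and geodesics\<close>

fun mpath :: "nat list list \<Rightarrow> bool" where
  "mpath [] = False"
| "mpath (v # q) = (valid v \<and> (q = [] \<or> edge v (hd q) \<and> mpath q))"

lemma mpath_valid: "mpath q \<Longrightarrow> set q \<subseteq> {v. valid v} \<and> q \<noteq> []"
  by (induction q) auto

lemma is_path_map:
  "set q \<subseteq> {v. valid v} \<Longrightarrow> is_path l m (map coset q) \<longleftrightarrow> mpath q"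
proof (induction q)
  case Nil
  then show ?case by (simp add: is_path_def)
next
  case (Cons v q)
  have "adj l m (coset v) (hd (map coset q)) \<longleftrightarrow> edge v (hd q)" if "q \<noteq> []"
    using Cons.prems that by (cases q) (auto simp: adj_coset_iff)
  then show ?case using Cons by (auto simp: is_path_Cons verts_eq)
qed

lemma is_path_iff: "is_path l m p \<longleftrightarrow> (\<exists>q. mpath q \<and> p = map coset q)"
proof
  assume p: "is_path l m p"
  then have "p \<in> lists (coset ` {v. valid v})" by (auto simp: is_path_def verts_eq)
  then obtain q where q: "set q \<subseteq> {v. valid v}" "p = map coset q" by (auto simp: lists_image)
  then show "\<exists>q. mpath q \<and> p = map coset q" using is_path_map p by blast
qed (use is_path_map mpath_valid in blast)

lemma edge_up:
  assumes "edge x y" "length x < length y"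
  shows "\<exists>i<deg x. y = child x i"
  using assms(1)
proof (cases rule: edge_cases)
  case (2 i)
  then have "length x = Suc (length y)" by simp
  then show ?thesis using assms(2) by simp
qed (use assms(2) in auto)

lemma edge_length: "edge x y \<Longrightarrow> length y \<le> Suc (length x)"
  by (erule edge_cases) auto

lemma mpath_length: "mpath q \<Longrightarrow> Suc (length (last q)) \<le> length (hd q) + length q"
proof (induction q)
  case (Cons v q)
  then show ?case using edge_length[of v "hd q"] by (cases "q = []") auto
qed simp

lemma mpath_snoc: "mpath q \<Longrightarrow> edge (last q) y \<Longrightarrow> mpath (q @ [y])"
  using edge_valid by (induction q) (auto simp: hd_append)

lemma ex_mpath: "valid v \<Longrightarrow> \<exists>q. mpath q \<and> hd q = [] \<and> last q = v \<and> length q = Suc (length v)"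
proof (induction v)
  case Nil
  then show ?case by (intro exI[of _ "[[]]"]) simp
next
  case (Cons i v)
  then obtain q where q: "mpath q" "hd q = []" "last q = v" "length q = Suc (length v)" by auto
  have "edge v (i # v)" using edge_child[of v i] Cons.prems by (auto simp: child_def)
  then show ?case using q mpath_snoc[OF q(1)] mpath_valid[OF q(1)]
    by (intro exI[of _ "q @ [i # v]"]) auto
qed

text \<open>The descending path, read backwards, has \<open>length v\<close> edges, and no edge
  raises the level by more than one.\<close>

lemma gdist_base:
  assumes v: "valid v"
  shows "gdist l m (coset []) (coset v) = length v"
  unfolding gdist_def
proof (rule Least_equality)
  obtain q where q: "mpath q" "hd q = []" "last q = v" "length q = Suc (length v)"
    using ex_mpath[OF v] by blast
  then show "\<exists>p. is_path l m p \<and> hd p = coset [] \<and> last p = coset v \<and> length p = Suc (length v)"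
    using mpath_valid[OF q(1)] is_path_iff
    by (intro exI[of _ "map coset q"]) (auto simp: hd_map last_map)
next
  fix n assume "\<exists>p. is_path l m p \<and> hd p = coset [] \<and> last p = coset v \<and> length p = Suc n"
  then obtain q where q: "mpath q" "hd (map coset q) = coset []" "last (map coset q) = coset v"
    "length q = Suc n" by (auto simp: is_path_iff)
  then have ne: "q \<noteq> []" "set q \<subseteq> {v. valid v}" using mpath_valid by auto
  have "valid (hd q)" using ne hd_in_set by blast
  then have "hd q = []" using q(2) ne inj_onD[OF inj_coset, of "hd q" "[]"] by (auto simp: hd_map)
  moreover have "valid (last q)" using ne last_in_set by blast
  then have "last q = v" using q(3) ne v inj_onD[OF inj_coset, of "last q" v] by (auto simp: last_map)
  ultimately show "length v \<le> n" using mpath_length[OF q(1)] q(4) by simp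
qed

section \<open>Ascending paths\<close>

definition ascents :: "nat \<Rightarrow> nat list \<Rightarrow> nat list list set" where
  "ascents n v = {q. mpath q \<and> hd q = v \<and> length q = Suc n \<and> length (last q) = length v + n}"

lemma geodesics_eq:
  "{p. geodesic_from_base l m p \<and> length p = Suc n} = map coset ` ascents n []"
proof (intro set_eqI iffI)
  fix p assume "p \<in> {p. geodesic_from_base l m p \<and> length p = Suc n}"
  then have p: "is_path l m p" "hd p = coset []" "gdist l m (hd p) (last p) = n" "length p = Suc n"
    by (auto simp: geodesic_from_base_def base_eq)
  then obtain q where q: "mpath q" "p = map coset q" by (auto simp: is_path_iff)
  then have ne: "q \<noteq> []" "set q \<subseteq> {v. valid v}" using mpath_valid by auto
  have "valid (hd q)" using ne hd_in_set by blast
  then have h: "hd q = []" using p(2) q ne inj_onD[OF inj_coset, of "hd q" "[]"] by (auto simp: hd_map)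
  have "valid (last q)" using ne last_in_set by blast
  then have "length (last q) = n"
    using p(2,3) q ne gdist_base[of "last q"] by (auto simp: last_map)
  then show "p \<in> map coset ` ascents n []" using q p(4) h by (auto simp: ascents_def)
next
  fix p assume "p \<in> map coset ` ascents n []"
  then obtain q where q: "mpath q" "p = map coset q" "hd q = []" "length q = Suc n" "length (last q) = n"
    by (auto simp: ascents_def)
  then have ne: "q \<noteq> []" "set q \<subseteq> {v. valid v}" using mpath_valid by auto
  then have "valid (last q)" using last_in_set by blast
  with ne show "p \<in> {p. geodesic_from_base l m p \<and> length p = Suc n}"
    using q gdist_base[of "last q"] is_path_iff last_in_set[of q]
    by (auto simp: geodesic_from_base_def base_eq hd_map last_map)
qed

lemma card_geodesics:
  "card {p. geodesic_from_base l m p \<and> length p = Suc n} = card (ascents n [])"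
proof -
  have "inj_on (map coset) (ascents n [])"
    using mpath_valid by (intro inj_on_mapI inj_on_subset[OF inj_coset]) (auto simp: ascents_def)
  then show ?thesis unfolding geodesics_eq by (rule card_image)
qed

lemma ascents_0: "valid v \<Longrightarrow> ascents 0 v = {[v]}"
  by (auto simp: ascents_def length_Suc_conv)

lemma ascents_Suc:
  assumes v: "valid v"
  shows "ascents (Suc n) v = (\<Union>i<deg v. (#) v ` ascents n (child v i))"
proof (intro set_eqI iffI)
  fix q assume "q \<in> ascents (Suc n) v"
  then have q: "mpath q" "hd q = v" "length q = Suc (Suc n)" "length (last q) = length v + Suc n"
    by (auto simp: ascents_def)
  then obtain q' where qq: "q = v # q'" "length q' = Suc n" by (cases q) auto
  then have "q' \<noteq> []" by auto
  then have q': "q = v # q'" "q' \<noteq> []" "edge v (hd q')" "mpath q'" "length q' = Suc n"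
    "length (last q') = length v + Suc n"
    using q qq by simp_all
  \<comment> \<open>The tail has \<open>n\<close> edges but ends \<open>n + 1\<close> levels above
    \<open>v\<close>, so the first edge has to ascend.\<close>
  have "length v < length (hd q')" using mpath_length[OF q'(4)] q'(5,6) by linarith
  then obtain i where i: "i < deg v" "hd q' = child v i" using edge_up[OF q'(3)] by blast
  have "q' \<in> ascents n (child v i)" unfolding ascents_def using q'(4-6) i(2) by simp
  then show "q \<in> (\<Union>i<deg v. (#) v ` ascents n (child v i))" unfolding q'(1) using i(1) by blast
next
  fix q assume "q \<in> (\<Union>i<deg v. (#) v ` ascents n (child v i))"
  then obtain i q' where "i < deg v" "q = v # q'" "q' \<in> ascents n (child v i)" by auto
  then show "q \<in> ascents (Suc n) v"
    using edge_child[OF v, of i] v mpath_valid[of q'] by (auto simp: ascents_def)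
qed

text \<open>The sum of \<open>f\<close> over the ends of the ascending paths with \<open>n\<close>
  edges from \<open>v\<close>, an end counting once per path.\<close>

fun psum :: "nat \<Rightarrow> (nat list \<Rightarrow> real) \<Rightarrow> nat list \<Rightarrow> real" where
  "psum 0 f v = f v"
| "psum (Suc n) f v = (\<Sum>i<deg v. psum n f (child v i))"

lemma card_ascents:
  "valid v \<Longrightarrow> finite (ascents n v) \<and> real (card (ascents n v)) = psum n (\<lambda>_. 1) v"
proof (induction n arbitrary: v)
  case 0
  then show ?case by (simp add: ascents_0)
next
  case (Suc n)
  have IH: "finite (ascents n (child v i))" "real (card (ascents n (child v i))) = psum n (\<lambda>_. 1) (child v i)"
    if "i < deg v" for i
    using Suc.IH[of "child v i"] valid_child Suc.prems that by auto
  have "card (\<Union>i<deg v. (#) v ` ascents n (child v i)) = (\<Sum>i<deg v. card ((#) v ` ascents n (child v i)))"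
  proof (rule card_UN_disjoint)
    show "\<forall>i\<in>{..<deg v}. \<forall>j\<in>{..<deg v}. i \<noteq> j \<longrightarrow>
        (#) v ` ascents n (child v i) \<inter> (#) v ` ascents n (child v j) = {}"
      using inj_child[OF Suc.prems] by (auto simp: ascents_def inj_on_def)
  qed (use IH in auto)
  then show ?case using IH Suc.prems by (simp add: ascents_Suc card_image)
qed

text \<open>Detaches the last edge instead of the first, so that local rules for children become
  recurrences in \<open>n\<close>.\<close>

lemma psum_Suc_right: "psum (Suc n) f v = psum n (\<lambda>u. \<Sum>i<deg u. f (child u i)) v"
proof (induction n arbitrary: v)
  case (Suc n)
  have "psum (Suc (Suc n)) f v = (\<Sum>i<deg v. psum (Suc n) f (child v i))" by (rule psum.simps)
  then show ?case by (simp only: Suc.IH psum.simps(2)[of n "\<lambda>u. \<Sum>i<deg u. f (child u i)"])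
qed simp

lemma psum_cong:
  assumes "\<And>u. valid u \<Longrightarrow> length u = length v + n \<Longrightarrow> f u = g u" "valid v"
  shows "psum n f v = psum n g v"
  using assms
proof (induction n arbitrary: v)
  case (Suc n)
  then show ?case using valid_child by (auto intro!: sum.cong Suc.IH)
qed simp

lemma psum_add: "psum n (\<lambda>u. f u + g u) v = psum n f v + psum n g v"
  by (induction n arbitrary: v) (simp_all add: sum.distrib)

lemma psum_cmult: "psum n (\<lambda>u. c * f u) v = c * psum n f v"
  by (induction n arbitrary: v) (simp_all add: sum_distrib_left)

lemma psum_sum: "psum n (\<lambda>u. \<Sum>j\<in>J. f j u) v = (\<Sum>j\<in>J. psum n (f j) v)"
proof (induction n arbitrary: v)
  case (Suc n)
  then show ?case by (simp add: sum.swap[of _ "{..<deg v}"])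
qed simp

text \<open>Along ascending edges the rules are symmetric: a shared child lies on the last edge of
  its left parent and the first edge of its right parent, although its code mentions only the left
  one.\<close>

lemma child_types:
  assumes "valid u" "i < deg u"
  defines "merged \<equiv> i = 0 \<and> lg u = K \<or> Suc i = deg u \<and> rg u = K"
  shows "np (child u i) = (if merged then 2 else 1)"
    "lg (child u i) = (if merged then 1 else if i > 0 then 1 else Suc (lg u))"
    "rg (child u i) = (if merged then 1 else if Suc i < deg u then 1 else Suc (rg u))"
  using assms prv_props[OF assms(1)] deg_pos[of "prv u"] by (auto simp: child_def typ_Cons)

lemma sum_first: "(n::nat) > 0 \<Longrightarrow> (\<Sum>i<n. of_bool (i = 0 \<and> b)) = (of_bool b :: real)"
  by (cases b) (auto simp: of_bool_def sum.delta)

lemma sum_last: "(n::nat) > 0 \<Longrightarrow> (\<Sum>i<n. of_bool (Suc i = n \<and> b)) = (of_bool b :: real)"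
proof -
  assume "n > 0"
  then obtain k where "n = Suc k" using gr0_implies_Suc by blast
  then show ?thesis by (cases b) (auto simp: of_bool_def sum.delta)
qed

section \<open>Gaps and shared vertices along ascending edges\<close>

definition gaps :: "nat \<Rightarrow> nat list \<Rightarrow> real" where
  "gaps h v = of_bool (lg v = h) + of_bool (rg v = h)"

definition merges :: "nat list \<Rightarrow> real" where
  "merges v = of_bool (np v = 2)"

text \<open>Gaps between siblings have height 1, so higher ones occur only outside the first and
  last child. \<open>deg_ge2\<close> excludes that a child raising one gap closes the other.\<close>

lemma sum_gaps_child:
  assumes "valid u" "1 \<le> h" "h < K"
  shows "(\<Sum>i<deg u. gaps (Suc h) (child u i)) = gaps h u"
proof -
  have "gaps (Suc h) (child u i) = of_bool (i = 0 \<and> lg u = h) + of_bool (Suc i = deg u \<and> rg u = h)"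
    if "i < deg u" for i
    using child_types[OF assms(1) that] deg_ge2[OF assms(1)] assms(2,3) that
    by (auto simp: gaps_def)
  then have "(\<Sum>i<deg u. gaps (Suc h) (child u i))
     = (\<Sum>i<deg u. of_bool (i = 0 \<and> lg u = h) + of_bool (Suc i = deg u \<and> rg u = h))"
    by (intro sum.cong) auto
  then show ?thesis using deg_pos[OF assms(1)] by (simp only: sum.distrib sum_first sum_last gaps_def)
qed

lemma sum_merges_child:
  assumes "valid u"
  shows "(\<Sum>i<deg u. merges (child u i)) = gaps K u"
proof -
  have "merges (child u i) = of_bool (i = 0 \<and> lg u = K) + of_bool (Suc i = deg u \<and> rg u = K)"
    if "i < deg u" for i
    using child_types[OF assms(1) that] deg_ge2[OF assms(1)] that
    by (auto simp: merges_def)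
  then have "(\<Sum>i<deg u. merges (child u i))
     = (\<Sum>i<deg u. of_bool (i = 0 \<and> lg u = K) + of_bool (Suc i = deg u \<and> rg u = K))"
    by (intro sum.cong) auto
  then show ?thesis using deg_pos[OF assms(1)] by (simp only: sum.distrib sum_first sum_last gaps_def)
qed

lemma deg_real:
  assumes "valid u" "u \<noteq> []"
  shows "real (deg u) = (real l - 1) + (- 1) * merges u + (- of_bool odd_face) * gaps w u"
proof -
  have "real (np u) + real (hz (lg u)) + real (hz (rg u)) + real (deg u) = real l"
    using np_sum[OF assms(1)] by linarith
  moreover have "real (np u) = 1 + merges u"
    using typ_invariant[OF assms] by (auto simp: merges_def)
  moreover have "real (hz (lg u)) + real (hz (rg u)) = of_bool odd_face * gaps w u"
    by (auto simp: hz_def gaps_def)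
  ultimately show ?thesis by linarith
qed

lemma sum_gaps:
  assumes "valid u" "u \<noteq> []"
  shows "(\<Sum>h=1..K. gaps h u) = 2"
proof -
  have "(\<Sum>h=1..K. of_bool (lg u = h)) = (1::real)" "(\<Sum>h=1..K. of_bool (rg u = h)) = (1::real)"
    using typ_invariant[OF assms] by (auto simp: of_bool_def sum.delta)
  then show ?thesis by (simp add: gaps_def sum.distrib)
qed

section \<open>Recurrences for the generating functions\<close>

definition P :: "real fps" where "P = Abs_fps (\<lambda>n. psum n (\<lambda>_. 1) [])"
definition A :: "nat \<Rightarrow> real fps" where "A h = Abs_fps (\<lambda>n. psum n (gaps h) [])"
definition B :: "real fps" where "B = Abs_fps (\<lambda>n. psum n merges [])"

lemma Gser_P: "Gser l m = P"
  using card_ascents[of "[]"] by (simp add: Gser_def P_def card_geodesics)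

lemma A_Suc:
  assumes "1 \<le> h" "h < K"
  shows "A (Suc h) = fps_X * A h"
proof (rule fps_ext)
  fix n
  show "fps_nth (A (Suc h)) n = fps_nth (fps_X * A h) n"
  proof (cases n)
    case 0
    \<comment> \<open>The base carries gap heights 0, so it adds nothing at positive
      heights.\<close>
    then show ?thesis by (simp add: A_def gaps_def)
  next
    case (Suc k)
    have "psum (Suc k) (gaps (Suc h)) [] = psum k (gaps h) []"
      unfolding psum_Suc_right by (rule psum_cong) (use sum_gaps_child assms in auto)
    then show ?thesis using Suc by (simp add: A_def del: psum.simps)
  qed
qed

lemma A_power: "h < K \<Longrightarrow> A (Suc h) = fps_X ^ h * A 1"
proof (induction h)
  case (Suc h)
  then show ?case using A_Suc[of "Suc h"] by (simp add: mult.assoc)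
qed simp

lemma B_eq: "B = fps_X * A K"
proof (rule fps_ext)
  fix n
  show "fps_nth B n = fps_nth (fps_X * A K) n"
  proof (cases n)
    case 0
    then show ?thesis by (simp add: B_def merges_def)
  next
    case (Suc k)
    have "psum (Suc k) merges [] = psum k (gaps K) []"
      unfolding psum_Suc_right by (rule psum_cong) (use sum_merges_child in auto)
    then show ?thesis using Suc by (simp add: A_def B_def del: psum.simps)
  qed
qed

lemma sum_A: "(\<Sum>h=1..K. A h) = 2 * (P - 1)"
proof (rule fps_ext)
  fix n
  show "fps_nth (\<Sum>h=1..K. A h) n = fps_nth (2 * (P - 1)) n"
  proof (cases n)
    case 0
    then show ?thesis by (simp add: A_def P_def gaps_def fps_sum_nth numeral_fps_const)
  next
    case (Suc k)
    have "(\<Sum>h=1..K. psum n (gaps h) []) = psum n (\<lambda>u. \<Sum>h=1..K. gaps h u) []"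
      by (simp only: psum_sum)
    also have "\<dots> = psum n (\<lambda>u. 2 * 1) []"
    proof (rule psum_cong)
      fix u :: "nat list"
      assume "valid u" "length u = length ([] :: nat list) + n"
      then show "(\<Sum>h=1..K. gaps h u) = 2 * 1" using sum_gaps[of u] Suc by fastforce
    qed simp
    also have "\<dots> = 2 * psum n (\<lambda>u. 1) []" by (rule psum_cmult)
    finally show ?thesis using Suc by (simp add: A_def P_def fps_sum_nth numeral_fps_const del: psum.simps)
  qed
qed

text \<open>From a vertex other than the base \<open>l - 1\<close> edges ascend, less one for a
  second parent and one per horizontal edge; from the base all \<open>l\<close> ascend.\<close>

lemma P_rec:
  "P = 1 + fps_X * (fps_const (real l) + fps_const (real l - 1) * (P - 1) - B - of_bool odd_face * A w)"
  (is "P = 1 + fps_X * ?R")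
proof (rule fps_ext)
  fix n
  have o: "of_bool odd_face = fps_const (of_bool odd_face :: real)" by simp
  show "fps_nth P n = fps_nth (1 + fps_X * ?R) n"
  proof (cases n)
    case 0
    then show ?thesis by (simp add: P_def)
  next
    case (Suc k)
    show ?thesis
    proof (cases k)
      case 0
      then show ?thesis using Suc w1
        by (simp add: P_def A_def B_def gaps_def merges_def o del: of_bool_eq)
    next
      case (Suc j)
      have "psum (Suc k) (\<lambda>_. 1) [] = psum k (\<lambda>u. real (deg u)) []"
        unfolding psum_Suc_right by simp
      also have "\<dots> = psum k (\<lambda>u. (real l - 1) * 1 + (- 1) * merges u + (- of_bool odd_face) * gaps w u) []"
      proof (rule psum_cong)
        fix u :: "nat list"
        assume "valid u" "length u = length ([] :: nat list) + k"
        then show "real (deg u) = (real l - 1) * 1 + (- 1) * merges u + (- of_bool odd_face) * gaps w u"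
          using deg_real[of u] Suc by fastforce
      qed simp
      also have "\<dots> = (real l - 1) * psum k (\<lambda>_. 1) [] - psum k merges []
          - of_bool odd_face * psum k (gaps w) []"
        unfolding psum_add psum_cmult by simp
      finally show ?thesis using \<open>n = Suc k\<close> Suc
        by (simp add: P_def A_def B_def o del: of_bool_eq psum.simps)
    qed
  qed
qed

definition E :: "real fps" where "E = (\<Sum>j<K. fps_X ^ j)"

text \<open>The factor of \<open>P - 1\<close> after \<open>A 1\<close> is eliminated from
  \<open>P_rec\<close>; it becomes the denominator.\<close>

definition D :: "real fps" where
  "D = E * (1 - fps_const (real l - 1) * fps_X) + 2 * fps_X ^ Suc K + 2 * of_bool odd_face * fps_X ^ w"

lemma E_A: "E * A 1 = 2 * (P - 1)"
proof -
  have "(\<Sum>h=1..K. A h) = (\<Sum>h<K. A (Suc h))"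
    by (rule sum.reindex_bij_witness[of _ Suc "\<lambda>h. h - 1"]) auto
  also have "\<dots> = (\<Sum>h<K. fps_X ^ h * A 1)" by (intro sum.cong refl A_power) simp
  finally show ?thesis using sum_A by (simp add: E_def sum_distrib_right)
qed

lemma P_mult_D: "P * D = D + fps_const (real l) * fps_X * E"
proof -
  define Q where "Q = P - 1"
  define c where "c = fps_const (real l - 1)"
  define L where "L = fps_const (real l)"
  define \<epsilon> :: "real fps" where "\<epsilon> = of_bool odd_face"
  have K: "A K = fps_X ^ (K - 1) * A 1" using A_power[of "K - 1"] K1 by simp
  \<comment> \<open>For even \<open>m\<close> the index \<open>w = K + 1\<close> is outside the
    range of \<open>A_power\<close>; there the factor \<open>\<epsilon>\<close> vanishes.\<close>
  have W: "\<epsilon> * A w = \<epsilon> * (fps_X ^ (w - 1) * A 1)"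
  proof (cases odd_face)
    case True
    then show ?thesis using A_power[of "w - 1"] w_le_K w1 by simp
  qed (simp add: \<epsilon>_def)
  have X: "fps_X * fps_X ^ (K - 1) = (fps_X ^ K :: real fps)" "fps_X * fps_X ^ (w - 1) = (fps_X ^ w :: real fps)"
    using K1 w1 by (simp_all flip: power_Suc)
  have "Q = fps_X * (L + c * Q - fps_X * A K - \<epsilon> * A w)"
    using P_rec unfolding B_eq Q_def c_def L_def \<epsilon>_def by (metis add_diff_cancel_left')
  also have "\<dots> = fps_X * L + fps_X * c * Q - fps_X * (fps_X * fps_X ^ (K - 1)) * A 1
      - \<epsilon> * (fps_X * fps_X ^ (w - 1)) * A 1"
    unfolding W K by (simp add: algebra_simps)
  finally have Q: "Q = fps_X * L + fps_X * c * Q - fps_X * fps_X ^ K * A 1 - \<epsilon> * fps_X ^ w * A 1"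
    unfolding X .
  \<comment> \<open>Multiplication by \<open>E\<close> replaces \<open>A 1\<close> by
    \<open>2 * Q\<close>, which leaves a linear equation for \<open>Q\<close>.\<close>
  have "E * Q = E * (fps_X * L + fps_X * c * Q - fps_X * fps_X ^ K * A 1 - \<epsilon> * fps_X ^ w * A 1)"
    using Q by simp
  also have "\<dots> = E * fps_X * L + E * fps_X * c * Q - fps_X * fps_X ^ K * (E * A 1) - \<epsilon> * fps_X ^ w * (E * A 1)"
    by (simp add: algebra_simps)
  finally have "E * Q = E * fps_X * L + E * fps_X * c * Q - fps_X * fps_X ^ K * (2 * Q) - \<epsilon> * fps_X ^ w * (2 * Q)"
    unfolding E_A Q_def .
  then have "Q * D = L * fps_X * E"
    unfolding D_def power_Suc c_def[symmetric] \<epsilon>_def[symmetric] by (simp add: algebra_simps)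
  then show ?thesis unfolding Q_def L_def by (simp add: algebra_simps)
qed

lemma E_nth: "fps_nth E n = (if n < K then 1 else 0)"
  by (auto simp: E_def fps_sum_nth fps_X_power_nth if_distrib cong: if_cong)

lemma D_nth_0: "fps_nth D 0 = 1"
  using K1 w1 by (simp add: D_def E_nth numeral_fps_const)

lemma Gser_quotient: "Gser l m = (D + fps_const (real l) * fps_X * E) / D"
proof -
  have "D \<noteq> 0" using D_nth_0 by auto
  then show ?thesis unfolding Gser_P P_mult_D[symmetric] by simp
qed

section \<open>The generating function\<close>

lemma D_nth:
  "fps_nth D n = of_bool (n < K) - (real l - 1) * of_bool (1 \<le> n \<and> n \<le> K)
     + 2 * of_bool (n = Suc K) + 2 * of_bool (odd_face \<and> n = w)"
proof -
  have D: "D = E - fps_const (real l - 1) * (fps_X * E) + fps_const 2 * fps_X ^ Suc K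
      + fps_const (2 * of_bool odd_face) * fps_X ^ w"
    by (simp add: D_def algebra_simps numeral_fps_const)
  show ?thesis unfolding D
    by (cases n) (auto simp: E_nth fps_X_power_nth simp del: power_Suc)
qed

lemma E_shift_nth:
  "fps_nth (fps_const (real l) * fps_X * E) n = real l * of_bool (1 \<le> n \<and> n \<le> K)"
  by (cases n) (auto simp: E_nth mult.assoc)

end

lemma fps_nth_sum_powers:
  "fps_nth (\<Sum>k=0..M. fps_const (g k) * fps_X ^ k) n = (if n \<le> M then g n else (0::real))"
  by (auto simp: fps_sum_nth fps_X_power_nth if_distrib cong: if_cong)

theorem mainTheorem3:
  fixes l m :: nat
  assumes "l \<ge> 3" and "m \<ge> 3" and "(l - 2) * (m - 2) \<ge> 4"
  shows "(\<forall>w. m = 2 * w \<longrightarrow>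
           Gser l m =
             ((\<Sum>k=0..w. (if k = 0 \<or> k = w then 1 else 2) * fps_X ^ k)
                + (fps_X ^ w - fps_X ^ (w - 1)))
           / ((\<Sum>k=0..w. fps_const (if k = 0 \<or> k = w then 1 else - (real l - 2)) * fps_X ^ k)
                + (fps_X ^ w - fps_X ^ (w - 1))))
       \<and> (\<forall>w. m = 2 * w + 1 \<longrightarrow>
           Gser l m =
             ((\<Sum>k=0..m-1. (if k = 0 \<or> k = m - 1 then 1 else if k = w then 4 else 2) * fps_X ^ k)
                + (fps_X ^ (m - 1) - fps_X ^ (m - 2)))
           / ((\<Sum>k=0..m-1. fps_const (if k = 0 \<or> k = m - 1 then 1
                             else if k = w then - (real l - 4) else - (real l - 2)) * fps_X ^ k)
                + (fps_X ^ (m - 1) - fps_X ^ (m - 2))))"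
proof -
  have curv: "l \<ge> 6 \<or> (l \<ge> 4 \<and> m \<ge> 4) \<or> m \<ge> 6"
  proof (rule ccontr)
    assume "\<not> ?thesis"
    \<comment> \<open>These are the spherical tessellations.\<close>
    then consider "l = 3" "m \<le> 5" | "l \<le> 5" "m = 3" using assms(1,2) by linarith
    then show False using assms(3) by cases auto
  qed
  interpret T: layers l m by unfold_locales (use assms curv in auto)
  note simps = T.D_nth T.E_nth T.E_shift_nth fps_nth_sum_powers fps_X_power_nth
  have even: "Gser l m =
             ((\<Sum>k=0..w. (if k = 0 \<or> k = w then 1 else 2) * fps_X ^ k)
                + (fps_X ^ w - fps_X ^ (w - 1)))
           / ((\<Sum>k=0..w. fps_const (if k = 0 \<or> k = w then 1 else - (real l - 2)) * fps_X ^ k)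
                + (fps_X ^ w - fps_X ^ (w - 1)))" (is "_ = ?N / ?D") if m: "m = 2 * w" for w
  proof -
    have K: "T.K = w - 1" "\<not> T.odd_face" "w \<ge> 2"
      unfolding T.K_def T.odd_face_def using m assms(2) by auto
    \<comment> \<open>The correction term makes the coefficients at \<open>w - 1\<close> and
      \<open>w\<close> equal to \<open>-(l - 1)\<close> and \<open>2\<close>.\<close>
    have D: "?D = T.D"
      by (rule fps_ext) (use K in \<open>auto simp: simps\<close>)
    have "?N = (\<Sum>k=0..w. fps_const (if k = 0 \<or> k = w then 1 else 2) * fps_X ^ k)
        + (fps_X ^ w - fps_X ^ (w - 1))"
      by (auto intro!: sum.cong simp: numeral_fps_const)
    also have "\<dots> = T.D + fps_const (real l) * fps_X * T.E"
      by (rule fps_ext) (use K in \<open>auto simp: simps\<close>)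
    finally show ?thesis unfolding D T.Gser_quotient by simp
  qed
  have odd: "Gser l m =
             ((\<Sum>k=0..m-1. (if k = 0 \<or> k = m - 1 then 1 else if k = w then 4 else 2) * fps_X ^ k)
                + (fps_X ^ (m - 1) - fps_X ^ (m - 2)))
           / ((\<Sum>k=0..m-1. fps_const (if k = 0 \<or> k = m - 1 then 1
                             else if k = w then - (real l - 4) else - (real l - 2)) * fps_X ^ k)
                + (fps_X ^ (m - 1) - fps_X ^ (m - 2)))" (is "_ = ?N / ?D") if m: "m = 2 * w + 1" for w
  proof -
    have K: "T.K = 2 * w - 1" "T.odd_face" "T.w = w" "w \<ge> 1"
      unfolding T.K_def T.odd_face_def T.w_def using m assms(2) by auto
    have m12: "m - 1 = 2 * w" "m - 2 = 2 * w - 1" using m by simp_all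
    \<comment> \<open>For \<open>w = 1\<close> the middle index \<open>w\<close> coincides with the
      index \<open>2 * w - 1\<close> of the correction term.\<close>
    have cases: "n = 0 \<or> n = w \<and> w = 1 \<or> n = w \<and> w > 1 \<or> n \<noteq> w \<and> 1 \<le> n \<and> n < 2 * w - 1
      \<or> n = 2 * w - 1 \<and> w > 1 \<or> n = 2 * w \<or> n > 2 * w" for n
      using K(4) by linarith
    have D: "?D = T.D"
    proof (rule fps_ext)
      fix n show "fps_nth ?D n = fps_nth T.D n"
        unfolding m12 using cases[of n] K by (elim disjE; (simp add: simps; arith?))
    qed
    have "?N = (\<Sum>k=0..m-1. fps_const (if k = 0 \<or> k = m - 1 then 1 else if k = w then 4 else 2) * fps_X ^ k)
        + (fps_X ^ (m - 1) - fps_X ^ (m - 2))"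
      by (auto intro!: sum.cong simp: numeral_fps_const)
    also have "\<dots> = T.D + fps_const (real l) * fps_X * T.E"
    proof (rule fps_ext)
      fix n show "fps_nth \<dots> n = fps_nth (T.D + fps_const (real l) * fps_X * T.E) n"
        unfolding m12 using cases[of n] K by (elim disjE; (simp add: simps; arith?))
    qed
    finally show ?thesis unfolding D T.Gser_quotient by simp
  qed
  show ?thesis using even odd by blast
qed

end
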